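(* Let $(S,D,C,E)$ be an umbra on a bicategory $\mathcal{B}$ taking values in a symmetric monoidal category $(\mathbf T,\otimes,I)$. Let $M,N\in\mathcal{B}(A,A)$ with $M$ left dualizable and $N$ right dualizable, and let $\phi\colon M\odot N\to N\odot M$ be a 2-cell in $\mathcal{B}$. Then $$\mathrm{tr}\big(S(N)\xrightarrow{\ \mathrm{tr}_M(\phi)\ }S(N)\big)=\mathrm{tr}\big(D(M)\xrightarrow{\ \mathrm{tr}_N(\phi)\ }D(M)\big),$$ where $\mathrm{tr}_M(\phi)$ is the bicategorical trace formed with the shadow $S$, $\mathrm{tr}_N(\phi)$ is the bicategorical trace formed with the shadow $D$, and the outer traces are symmetric monoidal traces in $\mathbf T$.
   Context: $\odot$ is composition of 1-cells in diagrammatic order, $U_A$ the identity 1-cell; associativity isomorphisms are suppressed. $(N,N')$ is a dual pair, $N\in\mathcal{B}(A,B)$ right dualizable with right dual $N'$, and $N'$ left dualizable with left dual $N$, if there are 2-cells $\eta\colon U_A\to N\odot N'$ and $\epsilon\colon N'\odot N\to U_B$ satisfying the triangle identities. A shadow on $\mathcal{B}$ with values in $\mathbf T$: functors $\mathcal{S}\colon\mathcal{B}(A,A)\to\mathbf T$ for all 0-cells $A$ and natural isomorphisms $\theta\colon\mathcal{S}(M\odot N)\to\mathcal{S}(N\odot M)$ ($M\in\mathcal{B}(A,B)$, $N\in\mathcal{B}(B,A)$) compatible with associativity (the composite $\mathcal S((M\odot N)\odot P)\xrightarrow{\theta}\mathcal S(P\odot(M\odot N))\cong\mathcal S((P\odot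 M)\odot N)$ equals $\mathcal S(M\odot(N\odot P))\xrightarrow{\theta}\mathcal S((N\odot P)\odot M)\cong\mathcal S(N\odot(P\odot M))\xrightarrow{\theta}\mathcal S((P\odot M)\odot N)$) and with units ($\mathcal S(M\odot U)\xrightarrow{\theta}\mathcal S(U\odot M)\to\mathcal S(M)$ and $\mathcal S(U\odot M)\xrightarrow{\theta}\mathcal S(M\odot U)\to\mathcal S(M)$ are the unit isomorphisms). A penumbra on $\mathcal{B}$ with values in a monoidal category $(\mathbf T,\otimes,I)$ consists of functors $S,D,C,E\colon\mathcal{B}(A,A)\to\mathbf T$ for all 0-cells $A$ and natural maps $r\colon D(M)\otimes C(N)\to D(M\odot N)$, $\lambda\colon D(M\odot N)\to E(M)\otimes D(N)$, $u\colon D(M)\otimes S(N)\to E(M\odot N)$, $s\colon C(M\odot N)\to S(M)\otimes D(N)$, $\ell\colon C(M)\otimes S(N)\to S(M\odot N)$, $\rho\colon S(M\odot N)\to S(M)\otimes E(N)$, $i\colon I\to C(U_A)$, $o\colon E(U_A)\to I$, such that: (1) $(\mathrm{id}\otimes u)(s\otimes\mathrm{id})=\rho\,\ell\colon C(M\odot N)\otimes S(P)\to S(M)\otimes E(N\odot P)$; (2) $(u\otimes\mathrm{id})(\mathrm{id}\otimes s)=\lambda\, r\colon D(M)\otimes C(N\odot P)\to E(M\odot N)\otimes D(P)$; (3) $(\mathrm{id}\otimes\lambda)s=(\rho\otimes\mathrm{id})s\colon C(M\odot N\odot P)\to S(M)\otimes E(N)\otimes D(P)$; (4) $u(\mathrm{id}\otimes\ell)=u(r\otimes\mathrm{id})\colon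 D(P)\otimes C(N)\otimes S(M)\to E(P\odot N\odot M)$; (5) $I\otimes S(M)\xrightarrow{i\otimes\mathrm{id}}C(U_A)\otimes S(M)\xrightarrow{\ell}S(U_A\odot M)\cong S(M)$ is the unit isomorphism; (6) $D(M)\otimes I\xrightarrow{\mathrm{id}\otimes i}D(M)\otimes C(U_A)\xrightarrow{r}D(M\odot U_A)\cong D(M)$ is the unit isomorphism; (7) $S(M\odot U_A)\xrightarrow{\rho}S(M)\otimes E(U_A)\xrightarrow{\mathrm{id}\otimes o}S(M)\otimes I\cong S(M)$ is the unit isomorphism; (8) $D(U_A\odot M)\xrightarrow{\lambda}E(U_A)\otimes D(M)\xrightarrow{o\otimes\mathrm{id}}I\otimes D(M)\cong D(M)$ is the unit isomorphism. A penumbra with values in a symmetric monoidal category (symmetry $\gamma$) is an umbra if $S$ and $D$ are shadows and the two composites $C(M\odot N\odot P)\to E(P\odot N\odot M)$ $$C(M\odot N\odot P)\xrightarrow{s}S(M\odot N)\otimes D(P)\xrightarrow{\theta\otimes\mathrm{id}}S(N\odot M)\otimes D(P)\xrightarrow{\gamma}D(P)\otimes S(N\odot M)\xrightarrow{u}E(P\odot N\odot M),$$ $$C(M\odot N\odot P)\xrightarrow{s}S(M)\otimes D(N\odot P)\xrightarrow{\mathrm{id}\otimes\theta}S(M)\otimes D(P\odot N)\xrightarrow{\gamma}D(P\odot N)\otimes S(M)\xrightarrow{u}E(P\odot N\odot M)$$ agree. Traces. With $N$ right dualizable with right dual $N'$, $\mathrm{tr}_N(\phi)$ is $D(M)\xrightarrow{\eta}D(M\odot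 N\odot N')\xrightarrow{\phi}D(N\odot M\odot N')\xrightarrow{\theta}D(N'\odot N\odot M)\xrightarrow{\epsilon}D(M)$. With $M$ left dualizable with left dual $'M$ (coevaluation $U_A\to{}'M\odot M$, evaluation $M\odot{}'M\to U_A$), $\mathrm{tr}_M(\phi)$ is $S(N)\to S({}'M\odot M\odot N)\xrightarrow{\phi}S({}'M\odot N\odot M)\xrightarrow{\theta}S(N\odot M\odot{}'M)\to S(N)$. In $\mathbf T$, the trace of $h\colon Z\to Z$ with $Z$ dualizable is $I\to Z\otimes Z^*\xrightarrow{h\otimes\mathrm{id}}Z\otimes Z^*\cong Z^*\otimes Z\to I$. For a dual pair $(N,N')$ in $\mathcal{B}(A,A)$, $(S(N),D(N'))$ is a dual pair in $\mathbf T$, so $S(N)$ and $D(M)$ are dualizable here. *)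

theory Defs
  imports Main
begin

section \<open>Categories and functors\<close>

text \<open>
  Composition is written in diagrammatic order throughout. Operations are not indexed by the
  boundaries of the cells they act on: a cell is regarded as carrying its source and target
  (this is no restriction, since every category or bicategory can be presented with pairwise
  disjoint hom-sets). Axioms are imposed only on cells whose boundaries match.
\<close>

record ('x, 'f) category =
  Ob :: "'x set"
  Hom :: "'x \<Rightarrow> 'x \<Rightarrow> 'f set"
  Idt :: "'x \<Rightarrow> 'f"
  Comp :: "'f \<Rightarrow> 'f \<Rightarrow> 'f"

locale category =
  fixes C :: "('x, 'f, 'z) category_scheme"
  assumes idt_hom: "x \<in> Ob C \<Longrightarrow> Idt C x \<in> Hom C x x"
    and comp_hom: "\<lbrakk>x \<in> Ob C; y \<in> Ob C; z \<in> Ob C; f \<in> Hom C x y; g \<in> Hom C y z\<rbrakk>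
      \<Longrightarrow> Comp C f g \<in> Hom C x z"
    and idt_comp: "\<lbrakk>x \<in> Ob C; y \<in> Ob C; f \<in> Hom C x y\<rbrakk> \<Longrightarrow> Comp C (Idt C x) f = f"
    and comp_idt: "\<lbrakk>x \<in> Ob C; y \<in> Ob C; f \<in> Hom C x y\<rbrakk> \<Longrightarrow> Comp C f (Idt C y) = f"
    and comp_assoc: "\<lbrakk>w \<in> Ob C; x \<in> Ob C; y \<in> Ob C; z \<in> Ob C;
        f \<in> Hom C w x; g \<in> Hom C x y; h \<in> Hom C y z\<rbrakk>
      \<Longrightarrow> Comp C (Comp C f g) h = Comp C f (Comp C g h)"

definition inverse_pair ::
  "('x, 'f, 'z) category_scheme \<Rightarrow> 'x \<Rightarrow> 'x \<Rightarrow> 'f \<Rightarrow> 'f \<Rightarrow> bool" where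
  "inverse_pair C x y f g \<longleftrightarrow> f \<in> Hom C x y \<and> g \<in> Hom C y x \<and>
     Comp C f g = Idt C x \<and> Comp C g f = Idt C y"

record ('x, 'f, 'y, 'g) fun_data =
  onOb :: "'x \<Rightarrow> 'y"  (infixl "\<cdot>\<^sub>o" 90)
  onHom :: "'f \<Rightarrow> 'g"  (infixl "\<cdot>\<^sub>h" 90)

locale cat_functor = C: category C + D: category D
  for C :: "('x, 'f, 'z) category_scheme" and D :: "('y, 'g, 'w) category_scheme" +
  fixes F :: "('x, 'f, 'y, 'g) fun_data"
  assumes ob_map: "x \<in> Ob C \<Longrightarrow> F \<cdot>\<^sub>o x \<in> Ob D"
    and hom_map: "\<lbrakk>x \<in> Ob C; y \<in> Ob C; f \<in> Hom C x y\<rbrakk>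
      \<Longrightarrow> F \<cdot>\<^sub>h f \<in> Hom D (F \<cdot>\<^sub>o x) (F \<cdot>\<^sub>o y)"
    and map_idt: "x \<in> Ob C \<Longrightarrow> F \<cdot>\<^sub>h Idt C x = Idt D (F \<cdot>\<^sub>o x)"
    and map_comp: "\<lbrakk>x \<in> Ob C; y \<in> Ob C; z \<in> Ob C; f \<in> Hom C x y; g \<in> Hom C y z\<rbrakk>
      \<Longrightarrow> F \<cdot>\<^sub>h Comp C f g = Comp D (F \<cdot>\<^sub>h f) (F \<cdot>\<^sub>h g)"


section \<open>Symmetric monoidal categories\<close>

text \<open>The structural isomorphisms come with their inverses (suffix \<open>i\<close>) as data; these are
  uniquely determined.\<close>

record ('x, 'f) moncat = "('x, 'f) category" +
  Tens :: "'x \<Rightarrow> 'x \<Rightarrow> 'x"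
  TensH :: "'f \<Rightarrow> 'f \<Rightarrow> 'f"
  TUnit :: 'x
  TAs :: "'x \<Rightarrow> 'x \<Rightarrow> 'x \<Rightarrow> 'f"
  TAsi :: "'x \<Rightarrow> 'x \<Rightarrow> 'x \<Rightarrow> 'f"
  TLu :: "'x \<Rightarrow> 'f"
  TLui :: "'x \<Rightarrow> 'f"
  TRu :: "'x \<Rightarrow> 'f"
  TRui :: "'x \<Rightarrow> 'f"

record ('x, 'f) smcat = "('x, 'f) moncat" +
  Sym :: "'x \<Rightarrow> 'x \<Rightarrow> 'f"

locale moncat_syntax =
  fixes T :: "('x, 'f, 'z) moncat_scheme"
begin
abbreviation comp_T (infixl "\<Zcomp>" 55) where "f \<Zcomp> g \<equiv> Comp T f g"
abbreviation tens_T (infixl "\<otimes>" 70) where "x \<otimes> y \<equiv> Tens T x y"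
abbreviation tensH_T (infixl "\<otimes>\<^sub>h" 70) where "f \<otimes>\<^sub>h g \<equiv> TensH T f g"
abbreviation "idt \<equiv> Idt T"
abbreviation "I \<equiv> TUnit T"
end

locale monoidal_category = category T + moncat_syntax T
  for T :: "('x, 'f, 'z) moncat_scheme" +
  assumes tens_ob: "\<lbrakk>x \<in> Ob T; y \<in> Ob T\<rbrakk> \<Longrightarrow> x \<otimes> y \<in> Ob T"
    and unit_ob: "I \<in> Ob T"
    and tens_hom: "\<lbrakk>x \<in> Ob T; x' \<in> Ob T; y \<in> Ob T; y' \<in> Ob T; f \<in> Hom T x x'; g \<in> Hom T y y'\<rbrakk>
      \<Longrightarrow> f \<otimes>\<^sub>h g \<in> Hom T (x \<otimes> y) (x' \<otimes> y')"
    and tens_idt: "\<lbrakk>x \<in> Ob T; y \<in> Ob T\<rbrakk> \<Longrightarrow> idt x \<otimes>\<^sub>h idt y = idt (x \<otimes> y)"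
    and tens_comp: "\<lbrakk>x \<in> Ob T; x' \<in> Ob T; x'' \<in> Ob T; y \<in> Ob T; y' \<in> Ob T; y'' \<in> Ob T;
        f \<in> Hom T x x'; f' \<in> Hom T x' x''; g \<in> Hom T y y'; g' \<in> Hom T y' y''\<rbrakk>
      \<Longrightarrow> (f \<Zcomp> f') \<otimes>\<^sub>h (g \<Zcomp> g') = (f \<otimes>\<^sub>h g) \<Zcomp> (f' \<otimes>\<^sub>h g')"
    and as_iso: "\<lbrakk>x \<in> Ob T; y \<in> Ob T; z \<in> Ob T\<rbrakk>
      \<Longrightarrow> inverse_pair T ((x \<otimes> y) \<otimes> z) (x \<otimes> (y \<otimes> z)) (TAs T x y z) (TAsi T x y z)"
    and lu_iso: "x \<in> Ob T \<Longrightarrow> inverse_pair T (I \<otimes> x) x (TLu T x) (TLui T x)"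
    and ru_iso: "x \<in> Ob T \<Longrightarrow> inverse_pair T (x \<otimes> I) x (TRu T x) (TRui T x)"
    and as_nat: "\<lbrakk>x \<in> Ob T; x' \<in> Ob T; y \<in> Ob T; y' \<in> Ob T; z \<in> Ob T; z' \<in> Ob T;
        f \<in> Hom T x x'; g \<in> Hom T y y'; h \<in> Hom T z z'\<rbrakk>
      \<Longrightarrow> ((f \<otimes>\<^sub>h g) \<otimes>\<^sub>h h) \<Zcomp> TAs T x' y' z' = TAs T x y z \<Zcomp> (f \<otimes>\<^sub>h (g \<otimes>\<^sub>h h))"
    and lu_nat: "\<lbrakk>x \<in> Ob T; x' \<in> Ob T; f \<in> Hom T x x'\<rbrakk>
      \<Longrightarrow> (idt I \<otimes>\<^sub>h f) \<Zcomp> TLu T x' = TLu T x \<Zcomp> f"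
    and ru_nat: "\<lbrakk>x \<in> Ob T; x' \<in> Ob T; f \<in> Hom T x x'\<rbrakk>
      \<Longrightarrow> (f \<otimes>\<^sub>h idt I) \<Zcomp> TRu T x' = TRu T x \<Zcomp> f"
    and pentagon: "\<lbrakk>w \<in> Ob T; x \<in> Ob T; y \<in> Ob T; z \<in> Ob T\<rbrakk>
      \<Longrightarrow> (TAs T w x y \<otimes>\<^sub>h idt z) \<Zcomp> TAs T w (x \<otimes> y) z \<Zcomp> (idt w \<otimes>\<^sub>h TAs T x y z)
        = TAs T (w \<otimes> x) y z \<Zcomp> TAs T w x (y \<otimes> z)"
    and triangle: "\<lbrakk>x \<in> Ob T; y \<in> Ob T\<rbrakk>
      \<Longrightarrow> TAs T x I y \<Zcomp> (idt x \<otimes>\<^sub>h TLu T y) = TRu T x \<otimes>\<^sub>h idt y"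

locale symmetric_monoidal_category = monoidal_category T
  for T :: "('x, 'f, 'z) smcat_scheme" +
  assumes sym_hom: "\<lbrakk>x \<in> Ob T; y \<in> Ob T\<rbrakk> \<Longrightarrow> Sym T x y \<in> Hom T (x \<otimes> y) (y \<otimes> x)"
    and sym_nat: "\<lbrakk>x \<in> Ob T; x' \<in> Ob T; y \<in> Ob T; y' \<in> Ob T; f \<in> Hom T x x'; g \<in> Hom T y y'\<rbrakk>
      \<Longrightarrow> (f \<otimes>\<^sub>h g) \<Zcomp> Sym T x' y' = Sym T x y \<Zcomp> (g \<otimes>\<^sub>h f)"
    and sym_sym: "\<lbrakk>x \<in> Ob T; y \<in> Ob T\<rbrakk> \<Longrightarrow> Sym T x y \<Zcomp> Sym T y x = idt (x \<otimes> y)"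
    and hexagon: "\<lbrakk>x \<in> Ob T; y \<in> Ob T; z \<in> Ob T\<rbrakk>
      \<Longrightarrow> TAs T x y z \<Zcomp> Sym T x (y \<otimes> z) \<Zcomp> TAs T y z x
        = (Sym T x y \<otimes>\<^sub>h idt z) \<Zcomp> TAs T y x z \<Zcomp> (idt y \<otimes>\<^sub>h Sym T x z)"

context moncat_syntax
begin

definition mon_dual_pair :: "'x \<Rightarrow> 'x \<Rightarrow> 'f \<Rightarrow> 'f \<Rightarrow> bool" where
  "mon_dual_pair z z' coev ev \<longleftrightarrow> z \<in> Ob T \<and> z' \<in> Ob T \<and>
     coev \<in> Hom T I (z \<otimes> z') \<and> ev \<in> Hom T (z' \<otimes> z) I \<and>
     TLui T z \<Zcomp> (coev \<otimes>\<^sub>h idt z) \<Zcomp> TAs T z z' z \<Zcomp> (idt z \<otimes>\<^sub>h ev) \<Zcomp> TRu T z = idt z \<and>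
     TRui T z' \<Zcomp> (idt z' \<otimes>\<^sub>h coev) \<Zcomp> TAsi T z' z z' \<Zcomp> (ev \<otimes>\<^sub>h idt z') \<Zcomp> TLu T z' = idt z'"

definition mon_dualizable :: "'x \<Rightarrow> bool" where
  "mon_dualizable z \<longleftrightarrow> (\<exists>z' coev ev. mon_dual_pair z z' coev ev)"

end

definition mon_trace ::
  "('x, 'f, 'z) smcat_scheme \<Rightarrow> 'x \<Rightarrow> 'x \<Rightarrow> 'f \<Rightarrow> 'f \<Rightarrow> 'f \<Rightarrow> 'f" where
  "mon_trace T z z' coev ev h =
     Comp T (Comp T (Comp T coev (TensH T h (Idt T z'))) (Sym T z z')) ev"


section \<open>Bicategories\<close>

text \<open>\<open>Cell1 B X Y\<close> and \<open>Cell2 B M N\<close> are the 1-cells \<open>X \<rightarrow> Y\<close> and the 2-cells \<open>M \<Rightarrow> N\<close>.\<close>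

record ('o, 'm, 'c) bicat =
  Cell0 :: "'o set"
  Cell1 :: "'o \<Rightarrow> 'o \<Rightarrow> 'm set"
  Cell2 :: "'m \<Rightarrow> 'm \<Rightarrow> 'c set"
  Id2 :: "'m \<Rightarrow> 'c"
  VComp :: "'c \<Rightarrow> 'c \<Rightarrow> 'c"
  HComp1 :: "'m \<Rightarrow> 'm \<Rightarrow> 'm"
  HComp2 :: "'c \<Rightarrow> 'c \<Rightarrow> 'c"
  BUnit :: "'o \<Rightarrow> 'm"
  BAs :: "'m \<Rightarrow> 'm \<Rightarrow> 'm \<Rightarrow> 'c"
  BAsi :: "'m \<Rightarrow> 'm \<Rightarrow> 'm \<Rightarrow> 'c"
  BLu :: "'m \<Rightarrow> 'c"
  BLui :: "'m \<Rightarrow> 'c"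
  BRu :: "'m \<Rightarrow> 'c"
  BRui :: "'m \<Rightarrow> 'c"

definition HomCat :: "('o, 'm, 'c, 'z) bicat_scheme \<Rightarrow> 'o \<Rightarrow> 'o \<Rightarrow> ('m, 'c) category" where
  "HomCat B X Y = \<lparr>Ob = Cell1 B X Y, Hom = Cell2 B, Idt = Id2 B, Comp = VComp B\<rparr>"

locale bicat_syntax =
  fixes B :: "('o, 'm, 'c, 'z) bicat_scheme"
begin
abbreviation "cell0 \<equiv> Cell0 B"
abbreviation "cell1 \<equiv> Cell1 B"
abbreviation "cell2 \<equiv> Cell2 B"
abbreviation vcomp_B (infixl "\<Zcomp>\<^sub>2" 55) where "f \<Zcomp>\<^sub>2 g \<equiv> VComp B f g"
abbreviation hcomp1_B (infixl "\<odot>" 70) where "M \<odot> N \<equiv> HComp1 B M N"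
abbreviation hcomp2_B (infixl "\<odot>\<^sub>2" 70) where "f \<odot>\<^sub>2 g \<equiv> HComp2 B f g"
abbreviation "id2 \<equiv> Id2 B"
abbreviation "U \<equiv> BUnit B"
abbreviation "as \<equiv> BAs B"
abbreviation "asi \<equiv> BAsi B"
abbreviation "lu \<equiv> BLu B"
abbreviation "lui \<equiv> BLui B"
abbreviation "ru \<equiv> BRu B"
abbreviation "rui \<equiv> BRui B"
end

locale bicategory = bicat_syntax B
  for B :: "('o, 'm, 'c, 'z) bicat_scheme" +
  assumes homcat: "\<lbrakk>W \<in> cell0; X \<in> cell0\<rbrakk> \<Longrightarrow> category (HomCat B W X)"
    and hcomp_1: "\<lbrakk>W \<in> cell0; X \<in> cell0; Y \<in> cell0; M \<in> cell1 W X; N \<in> cell1 X Y\<rbrakk>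
      \<Longrightarrow> M \<odot> N \<in> cell1 W Y"
    and bunit_1: "X \<in> cell0 \<Longrightarrow> U X \<in> cell1 X X"
    and hcomp_2: "\<lbrakk>W \<in> cell0; X \<in> cell0; Y \<in> cell0;
        M \<in> cell1 W X; M' \<in> cell1 W X; N \<in> cell1 X Y; N' \<in> cell1 X Y;
        f \<in> cell2 M M'; g \<in> cell2 N N'\<rbrakk>
      \<Longrightarrow> f \<odot>\<^sub>2 g \<in> cell2 (M \<odot> N) (M' \<odot> N')"
    and hcomp_id: "\<lbrakk>W \<in> cell0; X \<in> cell0; Y \<in> cell0; M \<in> cell1 W X; N \<in> cell1 X Y\<rbrakk>
      \<Longrightarrow> id2 M \<odot>\<^sub>2 id2 N = id2 (M \<odot> N)"
    and interchange: "\<lbrakk>W \<in> cell0; X \<in> cell0; Y \<in> cell0;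
        M \<in> cell1 W X; M' \<in> cell1 W X; M'' \<in> cell1 W X;
        N \<in> cell1 X Y; N' \<in> cell1 X Y; N'' \<in> cell1 X Y;
        f \<in> cell2 M M'; f' \<in> cell2 M' M''; g \<in> cell2 N N'; g' \<in> cell2 N' N''\<rbrakk>
      \<Longrightarrow> (f \<Zcomp>\<^sub>2 f') \<odot>\<^sub>2 (g \<Zcomp>\<^sub>2 g') = (f \<odot>\<^sub>2 g) \<Zcomp>\<^sub>2 (f' \<odot>\<^sub>2 g')"
    and bas_iso: "\<lbrakk>W \<in> cell0; X \<in> cell0; Y \<in> cell0; Z \<in> cell0;
        M \<in> cell1 W X; N \<in> cell1 X Y; P \<in> cell1 Y Z\<rbrakk>
      \<Longrightarrow> inverse_pair (HomCat B W Z) ((M \<odot> N) \<odot> P) (M \<odot> (N \<odot> P)) (as M N P) (asi M N P)"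
    and blu_iso: "\<lbrakk>X \<in> cell0; Y \<in> cell0; M \<in> cell1 X Y\<rbrakk>
      \<Longrightarrow> inverse_pair (HomCat B X Y) (U X \<odot> M) M (lu M) (lui M)"
    and bru_iso: "\<lbrakk>X \<in> cell0; Y \<in> cell0; M \<in> cell1 X Y\<rbrakk>
      \<Longrightarrow> inverse_pair (HomCat B X Y) (M \<odot> U Y) M (ru M) (rui M)"
    and bas_nat: "\<lbrakk>W \<in> cell0; X \<in> cell0; Y \<in> cell0; Z \<in> cell0;
        M \<in> cell1 W X; M' \<in> cell1 W X; N \<in> cell1 X Y; N' \<in> cell1 X Y;
        P \<in> cell1 Y Z; P' \<in> cell1 Y Z; f \<in> cell2 M M'; g \<in> cell2 N N'; h \<in> cell2 P P'\<rbrakk>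
      \<Longrightarrow> ((f \<odot>\<^sub>2 g) \<odot>\<^sub>2 h) \<Zcomp>\<^sub>2 as M' N' P' = as M N P \<Zcomp>\<^sub>2 (f \<odot>\<^sub>2 (g \<odot>\<^sub>2 h))"
    and blu_nat: "\<lbrakk>X \<in> cell0; Y \<in> cell0; M \<in> cell1 X Y; M' \<in> cell1 X Y; f \<in> cell2 M M'\<rbrakk>
      \<Longrightarrow> (id2 (U X) \<odot>\<^sub>2 f) \<Zcomp>\<^sub>2 lu M' = lu M \<Zcomp>\<^sub>2 f"
    and bru_nat: "\<lbrakk>X \<in> cell0; Y \<in> cell0; M \<in> cell1 X Y; M' \<in> cell1 X Y; f \<in> cell2 M M'\<rbrakk>
      \<Longrightarrow> (f \<odot>\<^sub>2 id2 (U Y)) \<Zcomp>\<^sub>2 ru M' = ru M \<Zcomp>\<^sub>2 f"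
    and bpentagon: "\<lbrakk>V \<in> cell0; W \<in> cell0; X \<in> cell0; Y \<in> cell0; Z \<in> cell0;
        M \<in> cell1 V W; N \<in> cell1 W X; P \<in> cell1 X Y; Q \<in> cell1 Y Z\<rbrakk>
      \<Longrightarrow> (as M N P \<odot>\<^sub>2 id2 Q) \<Zcomp>\<^sub>2 as M (N \<odot> P) Q \<Zcomp>\<^sub>2 (id2 M \<odot>\<^sub>2 as N P Q)
        = as (M \<odot> N) P Q \<Zcomp>\<^sub>2 as M N (P \<odot> Q)"
    and btriangle: "\<lbrakk>X \<in> cell0; Y \<in> cell0; Z \<in> cell0; M \<in> cell1 X Y; N \<in> cell1 Y Z\<rbrakk>
      \<Longrightarrow> as M (U Y) N \<Zcomp>\<^sub>2 (id2 M \<odot>\<^sub>2 lu N) = ru M \<odot>\<^sub>2 id2 N"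

text \<open>\<open>(N, N')\<close> is a dual pair: \<open>N\<close> is right dualizable with right dual \<open>N'\<close>, and \<open>N'\<close> is
  left dualizable with left dual \<open>N\<close>.\<close>

definition (in bicat_syntax) dual_pair :: "'o \<Rightarrow> 'o \<Rightarrow> 'm \<Rightarrow> 'm \<Rightarrow> 'c \<Rightarrow> 'c \<Rightarrow> bool" where
  "dual_pair X Y N N' \<eta> \<epsilon> \<longleftrightarrow> X \<in> cell0 \<and> Y \<in> cell0 \<and> N \<in> cell1 X Y \<and> N' \<in> cell1 Y X \<and>
     \<eta> \<in> cell2 (U X) (N \<odot> N') \<and> \<epsilon> \<in> cell2 (N' \<odot> N) (U Y) \<and>
     lui N \<Zcomp>\<^sub>2 (\<eta> \<odot>\<^sub>2 id2 N) \<Zcomp>\<^sub>2 as N N' N \<Zcomp>\<^sub>2 (id2 N \<odot>\<^sub>2 \<epsilon>) \<Zcomp>\<^sub>2 ru N = id2 N \<and>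
     rui N' \<Zcomp>\<^sub>2 (id2 N' \<odot>\<^sub>2 \<eta>) \<Zcomp>\<^sub>2 asi N' N N' \<Zcomp>\<^sub>2 (\<epsilon> \<odot>\<^sub>2 id2 N') \<Zcomp>\<^sub>2 lu N' = id2 N'"


section \<open>Shadows and bicategorical traces\<close>

locale shadow = bicategory B + category T
  for B :: "('o, 'm, 'c, 'z) bicat_scheme" and T :: "('x, 'f, 'w) category_scheme" +
  fixes F :: "('m, 'c, 'x, 'f) fun_data"
    and \<theta> :: "'m \<Rightarrow> 'm \<Rightarrow> 'f"
  assumes shadow_functor: "X \<in> cell0 \<Longrightarrow> cat_functor (HomCat B X X) T F"
    and \<theta>_iso: "\<lbrakk>X \<in> cell0; Y \<in> cell0; M \<in> cell1 X Y; N \<in> cell1 Y X\<rbrakk>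
      \<Longrightarrow> \<exists>\<theta>'. inverse_pair T (F \<cdot>\<^sub>o (M \<odot> N)) (F \<cdot>\<^sub>o (N \<odot> M)) (\<theta> M N) \<theta>'"
    and \<theta>_nat: "\<lbrakk>X \<in> cell0; Y \<in> cell0; M \<in> cell1 X Y; M' \<in> cell1 X Y;
        N \<in> cell1 Y X; N' \<in> cell1 Y X; f \<in> cell2 M M'; g \<in> cell2 N N'\<rbrakk>
      \<Longrightarrow> Comp T (F \<cdot>\<^sub>h (f \<odot>\<^sub>2 g)) (\<theta> M' N') = Comp T (\<theta> M N) (F \<cdot>\<^sub>h (g \<odot>\<^sub>2 f))"
    and \<theta>_assoc: "\<lbrakk>X \<in> cell0; Y \<in> cell0; Z \<in> cell0;
        M \<in> cell1 X Y; N \<in> cell1 Y Z; P \<in> cell1 Z X\<rbrakk>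
      \<Longrightarrow> Comp T (\<theta> (M \<odot> N) P) (F \<cdot>\<^sub>h asi P M N)
        = Comp T (Comp T (Comp T (F \<cdot>\<^sub>h as M N P) (\<theta> M (N \<odot> P))) (F \<cdot>\<^sub>h as N P M))
            (\<theta> N (P \<odot> M))"
    and \<theta>_unit_right: "\<lbrakk>X \<in> cell0; M \<in> cell1 X X\<rbrakk>
      \<Longrightarrow> Comp T (\<theta> M (U X)) (F \<cdot>\<^sub>h lu M) = F \<cdot>\<^sub>h ru M"
    and \<theta>_unit_left: "\<lbrakk>X \<in> cell0; M \<in> cell1 X X\<rbrakk>
      \<Longrightarrow> Comp T (\<theta> (U X) M) (F \<cdot>\<^sub>h ru M) = F \<cdot>\<^sub>h lu M"

locale trace_syntax = bicat_syntax B
  for B :: "('o, 'm, 'c, 'z) bicat_scheme" +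
  fixes T :: "('x, 'f, 'w) category_scheme"
    and F :: "('m, 'c, 'x, 'f) fun_data"
    and \<theta> :: "'m \<Rightarrow> 'm \<Rightarrow> 'f"
begin

abbreviation comp_tr (infixl "\<Zcomp>" 55) where "f \<Zcomp> g \<equiv> Comp T f g"

text \<open>The trace of \<open>\<phi> : M \<odot> N \<Rightarrow> N \<odot> M\<close> with respect to a dual pair \<open>(N, N')\<close>.\<close>

definition tr_right :: "'m \<Rightarrow> 'm \<Rightarrow> 'm \<Rightarrow> 'c \<Rightarrow> 'c \<Rightarrow> 'c \<Rightarrow> 'f" where
  "tr_right M N N' \<eta> \<epsilon> \<phi> =
     F \<cdot>\<^sub>h rui M \<Zcomp> F \<cdot>\<^sub>h (id2 M \<odot>\<^sub>2 \<eta>) \<Zcomp> F \<cdot>\<^sub>h asi M N N' \<Zcomp> F \<cdot>\<^sub>h (\<phi> \<odot>\<^sub>2 id2 N') \<Zcomp>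
     \<theta> (N \<odot> M) N' \<Zcomp>
     F \<cdot>\<^sub>h asi N' N M \<Zcomp> F \<cdot>\<^sub>h (\<epsilon> \<odot>\<^sub>2 id2 M) \<Zcomp> F \<cdot>\<^sub>h lu M"

text \<open>The trace of \<open>\<phi> : M \<odot> N \<Rightarrow> N \<odot> M\<close> with respect to a dual pair \<open>(M', M)\<close>, that is,
  \<open>M'\<close> is the left dual of \<open>M\<close>.\<close>

definition tr_left :: "'m \<Rightarrow> 'm \<Rightarrow> 'm \<Rightarrow> 'c \<Rightarrow> 'c \<Rightarrow> 'c \<Rightarrow> 'f" where
  "tr_left M N M' \<eta> \<epsilon> \<phi> =
     F \<cdot>\<^sub>h lui N \<Zcomp> F \<cdot>\<^sub>h (\<eta> \<odot>\<^sub>2 id2 N) \<Zcomp> F \<cdot>\<^sub>h as M' M N \<Zcomp> F \<cdot>\<^sub>h (id2 M' \<odot>\<^sub>2 \<phi>) \<Zcomp>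
     \<theta> M' (N \<odot> M) \<Zcomp>
     F \<cdot>\<^sub>h as N M M' \<Zcomp> F \<cdot>\<^sub>h (id2 N \<odot>\<^sub>2 \<epsilon>) \<Zcomp> F \<cdot>\<^sub>h ru N"

end


section \<open>Penumbras and umbras\<close>

text \<open>All associativity isomorphisms, of the bicategory and of the monoidal category, are written
  out. \<open>lam\<close> and \<open>rho\<close> stand for the transformations \<open>\<lambda>\<close> and \<open>\<rho>\<close>, and \<open>e A\<close> for the
  counit \<open>o : E(U\<^sub>A) \<rightarrow> I\<close>. A family of functors \<open>S : B(A,A) \<rightarrow> T\<close>, one for each 0-cell \<open>A\<close>, is
  a single pair of maps on 1- and 2-cells.\<close>

locale penumbra = bicategory B + monoidal_category T
  for B :: "('o, 'm, 'c, 'z) bicat_scheme" and T :: "('x, 'f, 'w) moncat_scheme" +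
  fixes S D C E :: "('m, 'c, 'x, 'f) fun_data"
    and r lam u s l rho :: "'m \<Rightarrow> 'm \<Rightarrow> 'f"
    and i e :: "'o \<Rightarrow> 'f"
  assumes functor_S: "A \<in> cell0 \<Longrightarrow> cat_functor (HomCat B A A) T S"
    and functor_D: "A \<in> cell0 \<Longrightarrow> cat_functor (HomCat B A A) T D"
    and functor_C: "A \<in> cell0 \<Longrightarrow> cat_functor (HomCat B A A) T C"
    and functor_E: "A \<in> cell0 \<Longrightarrow> cat_functor (HomCat B A A) T E"
    and r_hom: "\<lbrakk>A \<in> cell0; M \<in> cell1 A A; N \<in> cell1 A A\<rbrakk>
      \<Longrightarrow> r M N \<in> Hom T (D \<cdot>\<^sub>o M \<otimes> C \<cdot>\<^sub>o N) (D \<cdot>\<^sub>o (M \<odot> N))"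
    and lam_hom: "\<lbrakk>A \<in> cell0; M \<in> cell1 A A; N \<in> cell1 A A\<rbrakk>
      \<Longrightarrow> lam M N \<in> Hom T (D \<cdot>\<^sub>o (M \<odot> N)) (E \<cdot>\<^sub>o M \<otimes> D \<cdot>\<^sub>o N)"
    and u_hom: "\<lbrakk>A \<in> cell0; M \<in> cell1 A A; N \<in> cell1 A A\<rbrakk>
      \<Longrightarrow> u M N \<in> Hom T (D \<cdot>\<^sub>o M \<otimes> S \<cdot>\<^sub>o N) (E \<cdot>\<^sub>o (M \<odot> N))"
    and s_hom: "\<lbrakk>A \<in> cell0; M \<in> cell1 A A; N \<in> cell1 A A\<rbrakk>
      \<Longrightarrow> s M N \<in> Hom T (C \<cdot>\<^sub>o (M \<odot> N)) (S \<cdot>\<^sub>o M \<otimes> D \<cdot>\<^sub>o N)"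
    and l_hom: "\<lbrakk>A \<in> cell0; M \<in> cell1 A A; N \<in> cell1 A A\<rbrakk>
      \<Longrightarrow> l M N \<in> Hom T (C \<cdot>\<^sub>o M \<otimes> S \<cdot>\<^sub>o N) (S \<cdot>\<^sub>o (M \<odot> N))"
    and rho_hom: "\<lbrakk>A \<in> cell0; M \<in> cell1 A A; N \<in> cell1 A A\<rbrakk>
      \<Longrightarrow> rho M N \<in> Hom T (S \<cdot>\<^sub>o (M \<odot> N)) (S \<cdot>\<^sub>o M \<otimes> E \<cdot>\<^sub>o N)"
    and i_hom: "A \<in> cell0 \<Longrightarrow> i A \<in> Hom T I (C \<cdot>\<^sub>o U A)"
    and e_hom: "A \<in> cell0 \<Longrightarrow> e A \<in> Hom T (E \<cdot>\<^sub>o U A) I"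
    and r_nat: "\<lbrakk>A \<in> cell0; M \<in> cell1 A A; M' \<in> cell1 A A; N \<in> cell1 A A; N' \<in> cell1 A A;
        f \<in> cell2 M M'; g \<in> cell2 N N'\<rbrakk>
      \<Longrightarrow> (D \<cdot>\<^sub>h f \<otimes>\<^sub>h C \<cdot>\<^sub>h g) \<Zcomp> r M' N' = r M N \<Zcomp> D \<cdot>\<^sub>h (f \<odot>\<^sub>2 g)"
    and lam_nat: "\<lbrakk>A \<in> cell0; M \<in> cell1 A A; M' \<in> cell1 A A; N \<in> cell1 A A; N' \<in> cell1 A A;
        f \<in> cell2 M M'; g \<in> cell2 N N'\<rbrakk>
      \<Longrightarrow> D \<cdot>\<^sub>h (f \<odot>\<^sub>2 g) \<Zcomp> lam M' N' = lam M N \<Zcomp> (E \<cdot>\<^sub>h f \<otimes>\<^sub>h D \<cdot>\<^sub>h g)"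
    and u_nat: "\<lbrakk>A \<in> cell0; M \<in> cell1 A A; M' \<in> cell1 A A; N \<in> cell1 A A; N' \<in> cell1 A A;
        f \<in> cell2 M M'; g \<in> cell2 N N'\<rbrakk>
      \<Longrightarrow> (D \<cdot>\<^sub>h f \<otimes>\<^sub>h S \<cdot>\<^sub>h g) \<Zcomp> u M' N' = u M N \<Zcomp> E \<cdot>\<^sub>h (f \<odot>\<^sub>2 g)"
    and s_nat: "\<lbrakk>A \<in> cell0; M \<in> cell1 A A; M' \<in> cell1 A A; N \<in> cell1 A A; N' \<in> cell1 A A;
        f \<in> cell2 M M'; g \<in> cell2 N N'\<rbrakk>
      \<Longrightarrow> C \<cdot>\<^sub>h (f \<odot>\<^sub>2 g) \<Zcomp> s M' N' = s M N \<Zcomp> (S \<cdot>\<^sub>h f \<otimes>\<^sub>h D \<cdot>\<^sub>h g)"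
    and l_nat: "\<lbrakk>A \<in> cell0; M \<in> cell1 A A; M' \<in> cell1 A A; N \<in> cell1 A A; N' \<in> cell1 A A;
        f \<in> cell2 M M'; g \<in> cell2 N N'\<rbrakk>
      \<Longrightarrow> (C \<cdot>\<^sub>h f \<otimes>\<^sub>h S \<cdot>\<^sub>h g) \<Zcomp> l M' N' = l M N \<Zcomp> S \<cdot>\<^sub>h (f \<odot>\<^sub>2 g)"
    and rho_nat: "\<lbrakk>A \<in> cell0; M \<in> cell1 A A; M' \<in> cell1 A A; N \<in> cell1 A A; N' \<in> cell1 A A;
        f \<in> cell2 M M'; g \<in> cell2 N N'\<rbrakk>
      \<Longrightarrow> S \<cdot>\<^sub>h (f \<odot>\<^sub>2 g) \<Zcomp> rho M' N' = rho M N \<Zcomp> (S \<cdot>\<^sub>h f \<otimes>\<^sub>h E \<cdot>\<^sub>h g)"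
    and penumbra1: "\<lbrakk>A \<in> cell0; M \<in> cell1 A A; N \<in> cell1 A A; P \<in> cell1 A A\<rbrakk>
      \<Longrightarrow> (s M N \<otimes>\<^sub>h idt (S \<cdot>\<^sub>o P)) \<Zcomp> TAs T (S \<cdot>\<^sub>o M) (D \<cdot>\<^sub>o N) (S \<cdot>\<^sub>o P)
            \<Zcomp> (idt (S \<cdot>\<^sub>o M) \<otimes>\<^sub>h u N P)
        = l (M \<odot> N) P \<Zcomp> S \<cdot>\<^sub>h as M N P \<Zcomp> rho M (N \<odot> P)"
    and penumbra2: "\<lbrakk>A \<in> cell0; M \<in> cell1 A A; N \<in> cell1 A A; P \<in> cell1 A A\<rbrakk>
      \<Longrightarrow> (idt (D \<cdot>\<^sub>o M) \<otimes>\<^sub>h s N P) \<Zcomp> TAsi T (D \<cdot>\<^sub>o M) (S \<cdot>\<^sub>o N) (D \<cdot>\<^sub>o P)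
            \<Zcomp> (u M N \<otimes>\<^sub>h idt (D \<cdot>\<^sub>o P))
        = r M (N \<odot> P) \<Zcomp> D \<cdot>\<^sub>h asi M N P \<Zcomp> lam (M \<odot> N) P"
    and penumbra3: "\<lbrakk>A \<in> cell0; M \<in> cell1 A A; N \<in> cell1 A A; P \<in> cell1 A A\<rbrakk>
      \<Longrightarrow> C \<cdot>\<^sub>h as M N P \<Zcomp> s M (N \<odot> P) \<Zcomp> (idt (S \<cdot>\<^sub>o M) \<otimes>\<^sub>h lam N P)
        = s (M \<odot> N) P \<Zcomp> (rho M N \<otimes>\<^sub>h idt (D \<cdot>\<^sub>o P))
            \<Zcomp> TAs T (S \<cdot>\<^sub>o M) (E \<cdot>\<^sub>o N) (D \<cdot>\<^sub>o P)"
    and penumbra4: "\<lbrakk>A \<in> cell0; M \<in> cell1 A A; N \<in> cell1 A A; P \<in> cell1 A A\<rbrakk>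
      \<Longrightarrow> TAs T (D \<cdot>\<^sub>o P) (C \<cdot>\<^sub>o N) (S \<cdot>\<^sub>o M) \<Zcomp> (idt (D \<cdot>\<^sub>o P) \<otimes>\<^sub>h l N M) \<Zcomp> u P (N \<odot> M)
        = (r P N \<otimes>\<^sub>h idt (S \<cdot>\<^sub>o M)) \<Zcomp> u (P \<odot> N) M \<Zcomp> E \<cdot>\<^sub>h as P N M"
    and penumbra5: "\<lbrakk>A \<in> cell0; M \<in> cell1 A A\<rbrakk>
      \<Longrightarrow> (i A \<otimes>\<^sub>h idt (S \<cdot>\<^sub>o M)) \<Zcomp> l (U A) M \<Zcomp> S \<cdot>\<^sub>h lu M = TLu T (S \<cdot>\<^sub>o M)"
    and penumbra6: "\<lbrakk>A \<in> cell0; M \<in> cell1 A A\<rbrakk>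
      \<Longrightarrow> (idt (D \<cdot>\<^sub>o M) \<otimes>\<^sub>h i A) \<Zcomp> r M (U A) \<Zcomp> D \<cdot>\<^sub>h ru M = TRu T (D \<cdot>\<^sub>o M)"
    and penumbra7: "\<lbrakk>A \<in> cell0; M \<in> cell1 A A\<rbrakk>
      \<Longrightarrow> rho M (U A) \<Zcomp> (idt (S \<cdot>\<^sub>o M) \<otimes>\<^sub>h e A) \<Zcomp> TRu T (S \<cdot>\<^sub>o M) = S \<cdot>\<^sub>h ru M"
    and penumbra8: "\<lbrakk>A \<in> cell0; M \<in> cell1 A A\<rbrakk>
      \<Longrightarrow> lam (U A) M \<Zcomp> (e A \<otimes>\<^sub>h idt (D \<cdot>\<^sub>o M)) \<Zcomp> TLu T (D \<cdot>\<^sub>o M) = D \<cdot>\<^sub>h lu M"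

locale umbra =
  penumbra B T S D C E r lam u s l rho i e + symmetric_monoidal_category T +
  shadow_S: shadow B T S \<theta>S + shadow_D: shadow B T D \<theta>D
  for B :: "('o, 'm, 'c, 'z) bicat_scheme" and T :: "('x, 'f, 'w) smcat_scheme"
    and S D C E :: "('m, 'c, 'x, 'f) fun_data"
    and r lam u s l rho :: "'m \<Rightarrow> 'm \<Rightarrow> 'f"
    and i e :: "'o \<Rightarrow> 'f"
    and \<theta>S \<theta>D :: "'m \<Rightarrow> 'm \<Rightarrow> 'f" +
  assumes umbra: "\<lbrakk>A \<in> cell0; M \<in> cell1 A A; N \<in> cell1 A A; P \<in> cell1 A A\<rbrakk>
      \<Longrightarrow> s (M \<odot> N) P \<Zcomp> (\<theta>S M N \<otimes>\<^sub>h idt (D \<cdot>\<^sub>o P)) \<Zcomp> Sym T (S \<cdot>\<^sub>o (N \<odot> M)) (D \<cdot>\<^sub>o P)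
            \<Zcomp> u P (N \<odot> M)
        = C \<cdot>\<^sub>h as M N P \<Zcomp> s M (N \<odot> P) \<Zcomp> (idt (S \<cdot>\<^sub>o M) \<otimes>\<^sub>h \<theta>D N P)
            \<Zcomp> Sym T (S \<cdot>\<^sub>o M) (D \<cdot>\<^sub>o (P \<odot> N)) \<Zcomp> u (P \<odot> N) M \<Zcomp> E \<cdot>\<^sub>h as P N M"

end

theory Submission
  imports Defs
begin

text \<open>
  A trace in a symmetric monoidal category can be computed with any dual of the object
  (\<open>trace_dual_unique\<close>), and the umbra supplies convenient ones. The dual pair \<open>(N, N')\<close> makes
  \<open>D(N')\<close> a dual of \<open>S(N)\<close> with coevaluation \<open>I \<rightarrow> C(U) \<rightarrow> C(N \<odot> N') \<rightarrow> S(N) \<otimes> D(N')\<close> and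
  evaluation \<open>D(N') \<otimes> S(N) \<rightarrow> E(N' \<odot> N) \<rightarrow> E(U) \<rightarrow> I\<close>; the penumbra axioms turn the triangle
  identities of the bicategory into those of \<open>T\<close> (\<open>penumbra_dual_arrows\<close>). In the same way
  \<open>S(M')\<close> and \<open>D(M)\<close> are dual to each other.

  Put \<open>K = N \<odot> M\<close>, and compute the trace of \<open>tr\<^sub>M(\<phi>)\<close> with these data. The part of
  \<open>tr\<^sub>M(\<phi>)\<close> before the shadow isomorphism is the image under \<open>S\<close> of a 2-cell, which naturality of
  \<open>s\<close> moves back into \<open>C\<close>; the part after it is moved through the symmetry and \<open>u\<close> forward into
  \<open>E\<close>. What remains has the form
  \<open>I \<rightarrow> C(U) \<rightarrow> C((M' \<odot> K) \<odot> N') \<rightarrow> E(N' \<odot> (K \<odot> M')) \<rightarrow> E(U) \<rightarrow> I\<close>, where the middle map is one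
  side of the umbra axiom (\<open>trace_S_factor\<close>). The trace of \<open>tr\<^sub>N(\<phi>)\<close> becomes
  \<open>I \<rightarrow> C(U) \<rightarrow> C(M' \<odot> (K \<odot> N')) \<rightarrow> E((N' \<odot> K) \<odot> M') \<rightarrow> E(U) \<rightarrow> I\<close>, with the other side of the
  axiom in the middle (\<open>trace_D_factor\<close>). So only an identity between 2-cells of the bicategory
  remains on either side of the axiom: the two coevaluations can be inserted in either order
  (\<open>coev_slide\<close>), and the two evaluations can be applied in either order (\<open>ev_slide\<close>). Both are
  instances of interchange, once the coherence of the unit isomorphisms is available.

  All cells involved live over the single 0-cell \<open>A\<close>, so the bicategory enters only through the
  monoidal category \<open>End B A\<close> of endomorphisms of \<open>A\<close>, and every coherence fact is shown once, for
  monoidal categories.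

  A bare cell does not determine its boundary, so each use of associativity or naturality would
  have to name the intermediate objects. The calculations are therefore carried out with cells that
  are packed together with their source and target, for which boundaries can be computed by
  rewriting; the projection \<open>cell\<close> returns to the given operations.
\<close>

section \<open>Cells with boundary\<close>

text \<open>\<open>Null\<close> is the value of operations on arguments that do not match. It absorbs under composition
  and tensor, which frees many of the equations below from side conditions.\<close>
datatype ('x, 'f) arrow = Null | Arr (src: 'x) (cell: 'f) (tgt: 'x)

definition arr :: "('x, 'f, 'z) category_scheme \<Rightarrow> ('x, 'f) arrow \<Rightarrow> bool" where
  "arr C s \<longleftrightarrow> s \<noteq> Null \<and> src s \<in> Ob C \<and> tgt s \<in> Ob C \<and> cell s \<in> Hom C (src s) (tgt s)"

definition seq :: "('x, 'f, 'z) category_scheme \<Rightarrow> ('x, 'f) arrow \<Rightarrow> ('x, 'f) arrow \<Rightarrow> ('x, 'f) arrow"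
  where "seq C s t = (if arr C s \<and> arr C t \<and> tgt s = src t
    then Arr (src s) (Comp C (cell s) (cell t)) (tgt t) else Null)"

definition ident :: "('x, 'f, 'z) category_scheme \<Rightarrow> 'x \<Rightarrow> ('x, 'f) arrow" where
  "ident C x = Arr x (Idt C x) x"

lemma arr_Arr [simp]: "arr C (Arr x f y) \<longleftrightarrow> x \<in> Ob C \<and> y \<in> Ob C \<and> f \<in> Hom C x y"
  by (simp add: arr_def)

lemma arr_Null [simp]: "\<not> arr C Null"
  by (simp add: arr_def)

lemma arr_cell: "arr C s \<Longrightarrow> cell s \<in> Hom C (src s) (tgt s)"
  by (simp add: arr_def)

lemma arr_src [simp]: "arr C s \<Longrightarrow> src s \<in> Ob C"
  and arr_tgt [simp]: "arr C s \<Longrightarrow> tgt s \<in> Ob C"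
  by (simp_all add: arr_def)

lemma arrow_eqI: "\<lbrakk>arr C s; arr C t; src s = src t; tgt s = tgt t; cell s = cell t\<rbrakk> \<Longrightarrow> s = t"
  by (cases s; cases t) auto

lemma src_ident [simp]: "src (ident C x) = x"
  and tgt_ident [simp]: "tgt (ident C x) = x"
  and cell_ident [simp]: "cell (ident C x) = Idt C x"
  by (simp_all add: ident_def)

lemma seq_Null [simp]: "seq C Null t = Null" "seq C s Null = Null"
  by (simp_all add: seq_def)

lemma src_seq [simp]: "\<lbrakk>arr C s; arr C t; tgt s = src t\<rbrakk> \<Longrightarrow> src (seq C s t) = src s"
  and tgt_seq [simp]: "\<lbrakk>arr C s; arr C t; tgt s = src t\<rbrakk> \<Longrightarrow> tgt (seq C s t) = tgt t"
  and cell_seq [simp]: "\<lbrakk>arr C s; arr C t; tgt s = src t\<rbrakk> \<Longrightarrow> cell (seq C s t) = Comp C (cell s) (cell t)"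
  by (simp_all add: seq_def)

context category
begin

lemma arr_ident [simp]: "arr C (ident C x) \<longleftrightarrow> x \<in> Ob C"
  by (auto simp: ident_def idt_hom)

lemma arr_seq [simp]: "arr C (seq C s t) \<longleftrightarrow> arr C s \<and> arr C t \<and> tgt s = src t"
  by (auto simp: seq_def arr_cell intro!: comp_hom[of "src s" "src t" "tgt t"]) (metis arr_cell)

text \<open>Free of side conditions, since both bracketings are \<open>Null\<close> as soon as one of the three
  arrows is not an arrow of \<open>C\<close> or one of the two boundaries does not match. Hence a rewrite rule for
  a composite can be applied anywhere inside a longer composite.\<close>
lemma seq_assoc: "seq C (seq C s t) k = seq C s (seq C t k)"
proof (cases "arr C s \<and> arr C t \<and> arr C k \<and> tgt s = src t \<and> tgt t = src k")
  case True
  then show ?thesis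
    by (intro arrow_eqI[of C])
      (auto intro!: comp_assoc[of "src s" "src t" "src k" "tgt k"] simp: arr_cell, (metis arr_cell)+)
next
  case False
  have "seq C (seq C s t) k = Null" using False by (subst seq_def) auto
  moreover have "seq C s (seq C t k) = Null" using False by (subst seq_def) auto
  ultimately show ?thesis by simp
qed

lemma seq_ident_left [simp]: "\<lbrakk>arr C s; src s = x\<rbrakk> \<Longrightarrow> seq C (ident C x) s = s"
  by (rule arrow_eqI[of C]) (auto intro!: idt_comp[of _ "tgt s"] simp: arr_cell)

lemma seq_ident_right [simp]: "\<lbrakk>arr C s; tgt s = x\<rbrakk> \<Longrightarrow> seq C s (ident C x) = s"
  by (rule arrow_eqI[of C]) (auto intro!: comp_idt[of "src s"] simp: arr_cell)

text \<open>The form in which inverse laws act on composites that are bracketed to the right.\<close>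
lemma inverse_cancel: "\<lbrakk>seq C p q = ident C (src k); arr C k\<rbrakk> \<Longrightarrow> seq C p (seq C q k) = k"
  by (simp add: seq_assoc[symmetric])

text \<open>Together with \<open>seq_assoc\<close> this continues an equation between composites by a further arrow \<open>k\<close>.\<close>
lemma seq_extend: "a = b \<Longrightarrow> seq C a k = seq C b k"
  by simp

end

section \<open>Arrows of a monoidal category\<close>

definition tns :: "('x, 'f, 'z) moncat_scheme \<Rightarrow> ('x, 'f) arrow \<Rightarrow> ('x, 'f) arrow \<Rightarrow> ('x, 'f) arrow"
  where "tns T s t = (if arr T s \<and> arr T t
    then Arr (Tens T (src s) (src t)) (TensH T (cell s) (cell t)) (Tens T (tgt s) (tgt t)) else Null)"

lemma src_tns [simp]: "\<lbrakk>arr T s; arr T t\<rbrakk> \<Longrightarrow> src (tns T s t) = Tens T (src s) (src t)"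
  and tgt_tns [simp]: "\<lbrakk>arr T s; arr T t\<rbrakk> \<Longrightarrow> tgt (tns T s t) = Tens T (tgt s) (tgt t)"
  and cell_tns [simp]: "\<lbrakk>arr T s; arr T t\<rbrakk> \<Longrightarrow> cell (tns T s t) = TensH T (cell s) (cell t)"
  by (simp_all add: tns_def)

context moncat_syntax
begin

abbreviation seq_T (infixr "\<cdot>" 55) where "s \<cdot> t \<equiv> seq T s t"
abbreviation tns_T (infixl "\<star>" 70) where "s \<star> t \<equiv> tns T s t"
abbreviation "\<iota> \<equiv> ident T"

definition "\<alpha> x y z = Arr ((x \<otimes> y) \<otimes> z) (TAs T x y z) (x \<otimes> (y \<otimes> z))"
definition "\<alpha>' x y z = Arr (x \<otimes> (y \<otimes> z)) (TAsi T x y z) ((x \<otimes> y) \<otimes> z)"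
definition "lun x = Arr (I \<otimes> x) (TLu T x) x"
definition "lun' x = Arr x (TLui T x) (I \<otimes> x)"
definition "run x = Arr (x \<otimes> I) (TRu T x) x"
definition "run' x = Arr x (TRui T x) (x \<otimes> I)"

lemma structure_sels [simp]:
  "src (\<alpha> x y z) = (x \<otimes> y) \<otimes> z" "tgt (\<alpha> x y z) = x \<otimes> (y \<otimes> z)" "cell (\<alpha> x y z) = TAs T x y z"
  "src (\<alpha>' x y z) = x \<otimes> (y \<otimes> z)" "tgt (\<alpha>' x y z) = (x \<otimes> y) \<otimes> z" "cell (\<alpha>' x y z) = TAsi T x y z"
  "src (lun x) = I \<otimes> x" "tgt (lun x) = x" "cell (lun x) = TLu T x"
  "src (lun' x) = x" "tgt (lun' x) = I \<otimes> x" "cell (lun' x) = TLui T x"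
  "src (run x) = x \<otimes> I" "tgt (run x) = x" "cell (run x) = TRu T x"
  "src (run' x) = x" "tgt (run' x) = x \<otimes> I" "cell (run' x) = TRui T x"
  by (simp_all add: \<alpha>_def \<alpha>'_def lun_def lun'_def run_def run'_def)

end

context monoidal_category
begin

declare tens_ob [simp] unit_ob [simp]

lemma arr_tns [simp]: "arr T (s \<star> t) \<longleftrightarrow> arr T s \<and> arr T t"
  by (auto simp: tns_def arr_cell intro!: tens_hom)

lemma arr_structure [simp]:
  "\<lbrakk>x \<in> Ob T; y \<in> Ob T; z \<in> Ob T\<rbrakk> \<Longrightarrow> arr T (\<alpha> x y z)"
  "\<lbrakk>x \<in> Ob T; y \<in> Ob T; z \<in> Ob T\<rbrakk> \<Longrightarrow> arr T (\<alpha>' x y z)"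
  "x \<in> Ob T \<Longrightarrow> arr T (lun x)" "x \<in> Ob T \<Longrightarrow> arr T (lun' x)"
  "x \<in> Ob T \<Longrightarrow> arr T (run x)" "x \<in> Ob T \<Longrightarrow> arr T (run' x)"
  using as_iso[of x y z] lu_iso[of x] ru_iso[of x]
  by (simp_all add: \<alpha>_def \<alpha>'_def lun_def lun'_def run_def run'_def inverse_pair_def)

lemma structure_inverse [simp]:
  "\<lbrakk>x \<in> Ob T; y \<in> Ob T; z \<in> Ob T\<rbrakk> \<Longrightarrow> \<alpha> x y z \<cdot> \<alpha>' x y z = \<iota> ((x \<otimes> y) \<otimes> z)"
  "\<lbrakk>x \<in> Ob T; y \<in> Ob T; z \<in> Ob T\<rbrakk> \<Longrightarrow> \<alpha>' x y z \<cdot> \<alpha> x y z = \<iota> (x \<otimes> (y \<otimes> z))"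
  "x \<in> Ob T \<Longrightarrow> lun x \<cdot> lun' x = \<iota> (I \<otimes> x)" "x \<in> Ob T \<Longrightarrow> lun' x \<cdot> lun x = \<iota> x"
  "x \<in> Ob T \<Longrightarrow> run x \<cdot> run' x = \<iota> (x \<otimes> I)" "x \<in> Ob T \<Longrightarrow> run' x \<cdot> run x = \<iota> x"
  using as_iso[of x y z] lu_iso[of x] ru_iso[of x]
  by (auto intro!: arrow_eqI[of T] simp: inverse_pair_def)

lemma tns_ident [simp]: "\<lbrakk>x \<in> Ob T; y \<in> Ob T\<rbrakk> \<Longrightarrow> \<iota> x \<star> \<iota> y = \<iota> (x \<otimes> y)"
  by (rule arrow_eqI[of T]) (auto simp: tens_idt)

lemma tns_seq: "\<lbrakk>tgt s = src s'; tgt t = src t'\<rbrakk> \<Longrightarrow> (s \<cdot> s') \<star> (t \<cdot> t') = (s \<star> t) \<cdot> (s' \<star> t')"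
proof (cases "arr T s \<and> arr T s' \<and> arr T t \<and> arr T t'")
  case True
  assume "tgt s = src s'" "tgt t = src t'"
  with True show ?thesis
    by (intro arrow_eqI[of T])
      (auto intro!: tens_comp[of "src s" "src s'" "tgt s'" "src t" "src t'" "tgt t'"] simp: arr_cell, (metis arr_cell)+)
next
  case False
  then show ?thesis by (auto simp: tns_def seq_def)
qed

text \<open>Read from left to right, this and its mirror image bring every composite to the form of a chain of
  elementary cells tensored with identities, which is where naturality and the coherence axioms
  apply.\<close>
lemma whisker_right_seq: "tgt s = src s' \<Longrightarrow> (s \<cdot> s') \<star> \<iota> y = (s \<star> \<iota> y) \<cdot> (s' \<star> \<iota> y)"
  using tns_seq[of s s' "\<iota> y" "\<iota> y"] by (cases "y \<in> Ob T") (auto simp: tns_def)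

lemma whisker_left_seq: "tgt s = src s' \<Longrightarrow> \<iota> y \<star> (s \<cdot> s') = (\<iota> y \<star> s) \<cdot> (\<iota> y \<star> s')"
  using tns_seq[of "\<iota> y" "\<iota> y" s s'] by (cases "y \<in> Ob T") (auto simp: tns_def)

lemma whisker_exchange:
  assumes "arr T s" "arr T t"
  shows "(s \<star> \<iota> (src t)) \<cdot> (\<iota> (tgt s) \<star> t) = s \<star> t"
    and "(\<iota> (src s) \<star> t) \<cdot> (s \<star> \<iota> (tgt t)) = s \<star> t"
  using assms by (simp_all add: tns_seq[symmetric])

lemma \<alpha>_nat: "((s \<star> t) \<star> k) \<cdot> \<alpha> (tgt s) (tgt t) (tgt k) = \<alpha> (src s) (src t) (src k) \<cdot> (s \<star> (t \<star> k))"
proof (cases "arr T s \<and> arr T t \<and> arr T k")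
  case True
  then show ?thesis by (intro arrow_eqI[of T]) (auto simp: arr_cell intro!: as_nat)
qed (auto simp: tns_def)

lemma lun_nat: "(\<iota> I \<star> s) \<cdot> lun (tgt s) = lun (src s) \<cdot> s"
proof (cases "arr T s")
  case True
  then show ?thesis by (intro arrow_eqI[of T]) (auto simp: arr_cell intro!: lu_nat)
qed (auto simp: tns_def seq_def)

lemma run_nat: "(s \<star> \<iota> I) \<cdot> run (tgt s) = run (src s) \<cdot> s"
proof (cases "arr T s")
  case True
  then show ?thesis by (intro arrow_eqI[of T]) (auto simp: arr_cell intro!: ru_nat)
qed (auto simp: tns_def seq_def)

lemma pentagon_arrow: "\<lbrakk>w \<in> Ob T; x \<in> Ob T; y \<in> Ob T; z \<in> Ob T\<rbrakk> \<Longrightarrow>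
    (\<alpha> w x y \<star> \<iota> z) \<cdot> \<alpha> w (x \<otimes> y) z \<cdot> (\<iota> w \<star> \<alpha> x y z) = \<alpha> (w \<otimes> x) y z \<cdot> \<alpha> w x (y \<otimes> z)"
  unfolding seq_assoc[symmetric] by (rule arrow_eqI[of T]) (auto simp: pentagon)

lemma triangle_arrow: "\<lbrakk>x \<in> Ob T; y \<in> Ob T\<rbrakk> \<Longrightarrow> \<alpha> x I y \<cdot> (\<iota> x \<star> lun y) = run x \<star> \<iota> y"
  by (rule arrow_eqI[of T]) (auto simp: triangle)

section \<open>Coherence of the unit isomorphisms\<close>

lemma cancel_left: "\<lbrakk>p \<cdot> s = p \<cdot> t; q \<cdot> p = \<iota> x; arr T s; arr T t; src s = x; src t = x\<rbrakk> \<Longrightarrow> s = t"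
  by (metis seq_assoc seq_ident_left)

lemma cancel_right: "\<lbrakk>s \<cdot> p = t \<cdot> p; p \<cdot> q = \<iota> x; arr T s; arr T t; tgt s = x; tgt t = x\<rbrakk> \<Longrightarrow> s = t"
  by (metis seq_assoc seq_ident_right)

text \<open>Naturality of the unitor \<open>I \<otimes> x \<rightarrow> x\<close> conjugates \<open>I \<otimes> s\<close> to \<open>s\<close>, and unitors are invertible.\<close>
lemma unit_whisker_left_faithful:
  assumes "\<iota> I \<star> s = \<iota> I \<star> t" "arr T s" "arr T t" "src s = src t" "tgt s = tgt t"
  shows "s = t"
proof (rule cancel_left)
  show "lun (src s) \<cdot> s = lun (src s) \<cdot> t"
    using assms lun_nat[of s] lun_nat[of t] by simp
  show "lun' (src s) \<cdot> lun (src s) = \<iota> (src s)" using assms by simp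
qed (use assms in auto)

lemma unit_whisker_right_faithful:
  assumes "s \<star> \<iota> I = t \<star> \<iota> I" "arr T s" "arr T t" "src s = src t" "tgt s = tgt t"
  shows "s = t"
proof (rule cancel_left)
  show "run (src s) \<cdot> s = run (src s) \<cdot> t"
    using assms run_nat[of s] run_nat[of t] by simp
  show "run' (src s) \<cdot> run (src s) = \<iota> (src s)" using assms by simp
qed (use assms in auto)

lemma whiskered_inverse [simp]:
  "\<lbrakk>s \<cdot> t = \<iota> x; arr T s; arr T t; tgt s = src t; y \<in> Ob T; x \<in> Ob T\<rbrakk> \<Longrightarrow> (s \<star> \<iota> y) \<cdot> (t \<star> \<iota> y) = \<iota> (x \<otimes> y)"
  "\<lbrakk>s \<cdot> t = \<iota> x; arr T s; arr T t; tgt s = src t; y \<in> Ob T; x \<in> Ob T\<rbrakk> \<Longrightarrow> (\<iota> y \<star> s) \<cdot> (\<iota> y \<star> t) = \<iota> (y \<otimes> x)"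
  by (simp_all add: tns_seq[symmetric])

text \<open>The next three facts are Kelly's theorem that the unit coherences follow from the pentagon and
  the triangle. For the first, it is enough to compare the two sides after tensoring with \<open>I\<close>; the
  pentagon for \<open>I, I, x, y\<close> and two triangles identify them up to the invertible \<open>?p\<close>.\<close>
lemma lun_tensor:
  assumes [simp]: "x \<in> Ob T" "y \<in> Ob T"
  shows "\<alpha> I x y \<cdot> lun (x \<otimes> y) = lun x \<star> \<iota> y"
proof -
  let ?p = "(\<alpha> I I x \<star> \<iota> y) \<cdot> \<alpha> I (I \<otimes> x) y"
  have "?p \<cdot> (\<iota> I \<star> (\<alpha> I x y \<cdot> lun (x \<otimes> y)))
      = ((\<alpha> I I x \<star> \<iota> y) \<cdot> \<alpha> I (I \<otimes> x) y \<cdot> (\<iota> I \<star> \<alpha> I x y)) \<cdot> (\<iota> I \<star> lun (x \<otimes> y))"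
    by (simp add: whisker_left_seq seq_assoc)
  also have "\<dots> = \<alpha> (I \<otimes> I) x y \<cdot> \<alpha> I I (x \<otimes> y) \<cdot> (\<iota> I \<star> lun (x \<otimes> y))"
    by (subst pentagon_arrow) (simp_all add: seq_assoc)
  also have "\<dots> = \<alpha> (I \<otimes> I) x y \<cdot> (run I \<star> (\<iota> x \<star> \<iota> y))"
    by (simp add: triangle_arrow)
  also have "\<dots> = ((run I \<star> \<iota> x) \<star> \<iota> y) \<cdot> \<alpha> I x y"
    using \<alpha>_nat[of "run I" "\<iota> x" "\<iota> y"] by simp
  also have "\<dots> = (\<alpha> I I x \<star> \<iota> y) \<cdot> ((\<iota> I \<star> lun x) \<star> \<iota> y) \<cdot> \<alpha> I x y"
    by (simp add: triangle_arrow[symmetric] whisker_right_seq seq_assoc)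
  also have "\<dots> = ?p \<cdot> (\<iota> I \<star> (lun x \<star> \<iota> y))"
    using \<alpha>_nat[of "\<iota> I" "lun x" "\<iota> y"] by (simp add: seq_assoc)
  finally have "\<iota> I \<star> (\<alpha> I x y \<cdot> lun (x \<otimes> y)) = \<iota> I \<star> (lun x \<star> \<iota> y)"
    by (rule cancel_left[where q="\<alpha>' I (I \<otimes> x) y \<cdot> (\<alpha>' I I x \<star> \<iota> y)"])
      (simp_all add: seq_assoc inverse_cancel)
  then show ?thesis
    by (rule unit_whisker_left_faithful) simp_all
qed

text \<open>The mirror image, with the pentagon for \<open>x, y, I, I\<close>.\<close>
lemma run_tensor:
  assumes [simp]: "x \<in> Ob T" "y \<in> Ob T"
  shows "\<alpha> x y I \<cdot> (\<iota> x \<star> run y) = run (x \<otimes> y)"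
proof -
  let ?q = "\<alpha> x y I"
  have "((\<alpha> x y I \<cdot> (\<iota> x \<star> run y)) \<star> \<iota> I) \<cdot> ?q
      = (\<alpha> x y I \<star> \<iota> I) \<cdot> \<alpha> x (y \<otimes> I) I \<cdot> (\<iota> x \<star> (run y \<star> \<iota> I))"
    using \<alpha>_nat[of "\<iota> x" "run y" "\<iota> I"] by (simp add: whisker_right_seq seq_assoc)
  also have "\<dots> = ((\<alpha> x y I \<star> \<iota> I) \<cdot> \<alpha> x (y \<otimes> I) I \<cdot> (\<iota> x \<star> \<alpha> y I I)) \<cdot> (\<iota> x \<star> (\<iota> y \<star> lun I))"
    by (simp add: triangle_arrow[symmetric] whisker_left_seq seq_assoc)
  also have "\<dots> = \<alpha> (x \<otimes> y) I I \<cdot> \<alpha> x y (I \<otimes> I) \<cdot> (\<iota> x \<star> (\<iota> y \<star> lun I))"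
    by (subst pentagon_arrow) (simp_all add: seq_assoc)
  also have "\<dots> = \<alpha> (x \<otimes> y) I I \<cdot> (\<iota> (x \<otimes> y) \<star> lun I) \<cdot> ?q"
    using \<alpha>_nat[of "\<iota> x" "\<iota> y" "lun I"] by simp
  also have "\<dots> = (run (x \<otimes> y) \<star> \<iota> I) \<cdot> ?q"
    by (simp add: seq_assoc[symmetric] triangle_arrow)
  finally have "(\<alpha> x y I \<cdot> (\<iota> x \<star> run y)) \<star> \<iota> I = run (x \<otimes> y) \<star> \<iota> I"
    by (rule cancel_right[where q="\<alpha>' x y I"]) simp_all
  then show ?thesis
    by (rule unit_whisker_right_faithful) simp_all
qed

text \<open>Naturality of the left unitor at itself gives \<open>I \<otimes> \<lambda>\<^sub>I = \<lambda>\<^bsub>I\<otimes>I\<^esub>\<close>, so \<open>lun_tensor\<close> and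
  the triangle express both \<open>\<lambda>\<^sub>I \<otimes> I\<close> and \<open>\<rho>\<^sub>I \<otimes> I\<close> by the same composite.\<close>
lemma lun_unit_eq_run_unit: "lun I = run I"
proof (rule unit_whisker_right_faithful)
  have "\<iota> I \<star> lun I = lun (I \<otimes> I)"
    by (rule cancel_right[of _ "lun I" _ "lun' I"]) (use lun_nat[of "lun I"] in auto)
  then have "lun I \<star> \<iota> I = \<alpha> I I I \<cdot> (\<iota> I \<star> lun I)"
    by (simp add: lun_tensor)
  then show "lun I \<star> \<iota> I = run I \<star> \<iota> I"
    by (simp add: triangle_arrow)
qed simp_all

lemma \<alpha>'_nat: "(s \<star> (t \<star> k)) \<cdot> \<alpha>' (tgt s) (tgt t) (tgt k) = \<alpha>' (src s) (src t) (src k) \<cdot> ((s \<star> t) \<star> k)"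
proof (cases "arr T s \<and> arr T t \<and> arr T k")
  case True
  then have [simp]: "arr T s" "arr T t" "arr T k" by auto
  have "\<alpha>' (src s) (src t) (src k) \<cdot> ((s \<star> t) \<star> k)
      = \<alpha>' (src s) (src t) (src k) \<cdot> (((s \<star> t) \<star> k) \<cdot> \<alpha> (tgt s) (tgt t) (tgt k)) \<cdot> \<alpha>' (tgt s) (tgt t) (tgt k)"
    by (simp add: seq_assoc)
  also have "\<dots> = (\<alpha>' (src s) (src t) (src k) \<cdot> \<alpha> (src s) (src t) (src k)) \<cdot> (s \<star> (t \<star> k)) \<cdot> \<alpha>' (tgt s) (tgt t) (tgt k)"
    unfolding \<alpha>_nat by (simp only: seq_assoc)
  finally show ?thesis by simp
qed (auto simp: tns_def)

lemma lun'_nat: "s \<cdot> lun' (tgt s) = lun' (src s) \<cdot> (\<iota> I \<star> s)"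
proof (cases "arr T s")
  case True
  then have [simp]: "arr T s" .
  have "lun' (src s) \<cdot> (\<iota> I \<star> s) = lun' (src s) \<cdot> ((\<iota> I \<star> s) \<cdot> lun (tgt s)) \<cdot> lun' (tgt s)"
    by (simp add: seq_assoc)
  also have "\<dots> = (lun' (src s) \<cdot> lun (src s)) \<cdot> s \<cdot> lun' (tgt s)"
    unfolding lun_nat by (simp only: seq_assoc)
  finally show ?thesis by simp
qed (auto simp: tns_def seq_def)

lemma run'_nat: "s \<cdot> run' (tgt s) = run' (src s) \<cdot> (s \<star> \<iota> I)"
proof (cases "arr T s")
  case True
  then have [simp]: "arr T s" .
  have "run' (src s) \<cdot> (s \<star> \<iota> I) = run' (src s) \<cdot> ((s \<star> \<iota> I) \<cdot> run (tgt s)) \<cdot> run' (tgt s)"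
    by (simp add: seq_assoc)
  also have "\<dots> = (run' (src s) \<cdot> run (src s)) \<cdot> s \<cdot> run' (tgt s)"
    unfolding run_nat by (simp only: seq_assoc)
  finally show ?thesis by simp
qed (auto simp: tns_def seq_def)

text \<open>A right inverse \<open>q\<close> and a left inverse \<open>q'\<close> of the same arrow \<open>p\<close> agree. This transfers the unit
  coherences to the inverse unitors.\<close>
lemma inverse_unique:
  "\<lbrakk>p \<cdot> q = \<iota> x; q' \<cdot> p = \<iota> y; arr T q; arr T q'; src q = y; tgt q' = x\<rbrakk> \<Longrightarrow> q = q'"
  by (metis seq_assoc seq_ident_left seq_ident_right)

lemma lun'_tensor:
  assumes [simp]: "x \<in> Ob T" "y \<in> Ob T"
  shows "lun' (x \<otimes> y) \<cdot> \<alpha>' I x y = lun' x \<star> \<iota> y"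
proof (rule inverse_unique)
  show "(lun x \<star> \<iota> y) \<cdot> lun' (x \<otimes> y) \<cdot> \<alpha>' I x y = \<iota> ((I \<otimes> x) \<otimes> y)"
    unfolding lun_tensor[symmetric, OF assms]
    by (simp add: seq_assoc seq_assoc[of "lun (x \<otimes> y)", symmetric])
qed simp_all

lemma run'_tensor:
  assumes [simp]: "x \<in> Ob T" "y \<in> Ob T"
  shows "run' (x \<otimes> y) \<cdot> \<alpha> x y I = \<iota> x \<star> run' y"
proof (rule inverse_unique)
  show "(\<iota> x \<star> run y) \<cdot> run' (x \<otimes> y) \<cdot> \<alpha> x y I = \<iota> (x \<otimes> (y \<otimes> I))"
  proof -
    have "\<iota> x \<star> run y = \<alpha>' x y I \<cdot> run (x \<otimes> y)"
      by (simp add: run_tensor[symmetric] seq_assoc[symmetric])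
    then show ?thesis
      by (simp add: seq_assoc seq_assoc[of "run (x \<otimes> y)", symmetric])
  qed
qed simp_all

lemma run_tensor': "\<lbrakk>x \<in> Ob T; y \<in> Ob T\<rbrakk> \<Longrightarrow> \<alpha>' x y I \<cdot> run (x \<otimes> y) = \<iota> x \<star> run y"
  by (simp add: run_tensor[symmetric] seq_assoc[symmetric])

lemma triangle':
  assumes [simp]: "x \<in> Ob T" "y \<in> Ob T"
  shows "(run' x \<star> \<iota> y) \<cdot> \<alpha> x I y = \<iota> x \<star> lun' y"
proof (rule inverse_unique)
  show "(\<iota> x \<star> lun y) \<cdot> (run' x \<star> \<iota> y) \<cdot> \<alpha> x I y = \<iota> (x \<otimes> (I \<otimes> y))"
  proof -
    have "\<iota> x \<star> lun y = \<alpha>' x I y \<cdot> (run x \<star> \<iota> y)"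
      by (simp add: triangle_arrow[symmetric] seq_assoc[symmetric])
    then show ?thesis
      by (simp add: seq_assoc seq_assoc[of "run x \<star> \<iota> y", symmetric])
  qed
qed simp_all

lemma lun'_unit_eq_run'_unit: "lun' I = run' I"
  by (rule inverse_unique[of "run I" _ "I \<otimes> I" _ I])
    (use lun_unit_eq_run_unit in \<open>metis structure_inverse(3) unit_ob\<close>, simp_all)

text \<open>The pentagon solved for two of its edges, with the associators pointing in different directions.\<close>
lemma pentagon_mixed:
  assumes [simp]: "w \<in> Ob T" "x \<in> Ob T" "y \<in> Ob T" "z \<in> Ob T"
  shows "\<alpha> w x (y \<otimes> z) \<cdot> (\<iota> w \<star> \<alpha>' x y z)
    = \<alpha>' (w \<otimes> x) y z \<cdot> (\<alpha> w x y \<star> \<iota> z) \<cdot> \<alpha> w (x \<otimes> y) z"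
proof -
  have "\<alpha> w x (y \<otimes> z) \<cdot> (\<iota> w \<star> \<alpha>' x y z)
      = \<alpha>' (w \<otimes> x) y z \<cdot> (\<alpha> (w \<otimes> x) y z \<cdot> \<alpha> w x (y \<otimes> z)) \<cdot> (\<iota> w \<star> \<alpha>' x y z)"
    by (simp add: seq_assoc seq_assoc[of "\<alpha>' (w \<otimes> x) y z", symmetric])
  also have "\<dots> = \<alpha>' (w \<otimes> x) y z \<cdot> (\<alpha> w x y \<star> \<iota> z) \<cdot> \<alpha> w (x \<otimes> y) z"
    by (simp add: pentagon_arrow[symmetric] seq_assoc)
  finally show ?thesis .
qed

lemma pentagon_mixed':
  assumes [simp]: "w \<in> Ob T" "x \<in> Ob T" "y \<in> Ob T" "z \<in> Ob T"
  shows "(\<alpha>' w x y \<star> \<iota> z) \<cdot> \<alpha> (w \<otimes> x) y z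
    = \<alpha> w (x \<otimes> y) z \<cdot> (\<iota> w \<star> \<alpha> x y z) \<cdot> \<alpha>' w x (y \<otimes> z)"
proof -
  have "(\<alpha>' w x y \<star> \<iota> z) \<cdot> \<alpha> (w \<otimes> x) y z
      = (\<alpha>' w x y \<star> \<iota> z) \<cdot> (\<alpha> (w \<otimes> x) y z \<cdot> \<alpha> w x (y \<otimes> z)) \<cdot> \<alpha>' w x (y \<otimes> z)"
    by (simp add: seq_assoc)
  also have "\<dots> = \<alpha> w (x \<otimes> y) z \<cdot> (\<iota> w \<star> \<alpha> x y z) \<cdot> \<alpha>' w x (y \<otimes> z)"
    by (simp add: pentagon_arrow[symmetric] seq_assoc seq_assoc[of "\<alpha>' w x y \<star> \<iota> z", symmetric])
  finally show ?thesis .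
qed

section \<open>Dual pairs\<close>

definition dual_shape :: "'x \<Rightarrow> 'x \<Rightarrow> ('x, 'f) arrow \<Rightarrow> ('x, 'f) arrow \<Rightarrow> bool" where
  "dual_shape x y c e \<longleftrightarrow> x \<in> Ob T \<and> y \<in> Ob T \<and>
     arr T c \<and> src c = I \<and> tgt c = x \<otimes> y \<and> arr T e \<and> src e = y \<otimes> x \<and> tgt e = I"

text \<open>The two triangle identities are kept apart because exchanging the members of a dual pair in a
  symmetric category exchanges them.\<close>
definition zigzag :: "'x \<Rightarrow> 'x \<Rightarrow> ('x, 'f) arrow \<Rightarrow> ('x, 'f) arrow \<Rightarrow> bool" where
  "zigzag x y c e \<longleftrightarrow> dual_shape x y c e \<and>
     lun' x \<cdot> (c \<star> \<iota> x) \<cdot> \<alpha> x y x \<cdot> (\<iota> x \<star> e) \<cdot> run x = \<iota> x"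

definition zagzig :: "'x \<Rightarrow> 'x \<Rightarrow> ('x, 'f) arrow \<Rightarrow> ('x, 'f) arrow \<Rightarrow> bool" where
  "zagzig x y c e \<longleftrightarrow> dual_shape x y c e \<and>
     run' y \<cdot> (\<iota> y \<star> c) \<cdot> \<alpha>' y x y \<cdot> (e \<star> \<iota> y) \<cdot> lun y = \<iota> y"

definition dual_arrows :: "'x \<Rightarrow> 'x \<Rightarrow> ('x, 'f) arrow \<Rightarrow> ('x, 'f) arrow \<Rightarrow> bool" where
  "dual_arrows x y c e \<longleftrightarrow> zigzag x y c e \<and> zagzig x y c e"

lemma dual_arrows_iff:
  "dual_arrows x y (Arr I c (x \<otimes> y)) (Arr (y \<otimes> x) e I) \<longleftrightarrow> mon_dual_pair x y c e"
proof (cases "x \<in> Ob T \<and> y \<in> Ob T \<and> c \<in> Hom T I (x \<otimes> y) \<and> e \<in> Hom T (y \<otimes> x) I")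
  case True
  let ?c = "Arr I c (x \<otimes> y)" and ?e = "Arr (y \<otimes> x) e I"
  have *: "s = t \<longleftrightarrow> cell s = cell t" if "arr T s" "arr T t" "src s = src t" "tgt s = tgt t" for s t
    using arrow_eqI[of T s t] that by blast
  have "zigzag x y ?c ?e \<longleftrightarrow> cell ((((lun' x \<cdot> (?c \<star> \<iota> x)) \<cdot> \<alpha> x y x) \<cdot> (\<iota> x \<star> ?e)) \<cdot> run x) = cell (\<iota> x)"
    using True by (subst *[symmetric]) (simp_all add: zigzag_def dual_shape_def seq_assoc)
  moreover have "zagzig x y ?c ?e \<longleftrightarrow> cell ((((run' y \<cdot> (\<iota> y \<star> ?c)) \<cdot> \<alpha>' y x y) \<cdot> (?e \<star> \<iota> y)) \<cdot> lun y) = cell (\<iota> y)"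
    using True by (subst *[symmetric]) (simp_all add: zagzig_def dual_shape_def seq_assoc)
  ultimately show ?thesis
    using True by (simp add: dual_arrows_def mon_dual_pair_def)
qed (auto simp: dual_arrows_def mon_dual_pair_def zigzag_def dual_shape_def)

lemma mon_dualizableI:
  assumes "dual_arrows x y c e"
  shows "mon_dualizable x"
proof -
  have "c = Arr I (cell c) (x \<otimes> y)" "e = Arr (y \<otimes> x) (cell e) I"
    using assms by (cases c; cases e; auto simp: dual_arrows_def zigzag_def dual_shape_def)+
  then show ?thesis
    using assms dual_arrows_iff unfolding mon_dualizable_def by metis
qed

text \<open>The canonical comparison \<open>y \<rightarrow> w\<close> from one dual of \<open>x\<close> to another: create \<open>x \<otimes> w\<close> next to \<open>y\<close>,
  then cancel \<open>y\<close> against \<open>x\<close>.\<close>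
definition mate :: "'x \<Rightarrow> 'x \<Rightarrow> 'x \<Rightarrow> ('x, 'f) arrow \<Rightarrow> ('x, 'f) arrow \<Rightarrow> ('x, 'f) arrow" where
  "mate x y w c' e = run' y \<cdot> (\<iota> y \<star> c') \<cdot> \<alpha>' y x w \<cdot> (e \<star> \<iota> w) \<cdot> lun w"

text \<open>In string diagrams: following \<open>c\<close> by the comparison produces \<open>c'\<close> with its strand \<open>x\<close> bent down
  by \<open>e\<close> and up by \<open>c\<close>, and the triangle identity for \<open>(x, y)\<close> straightens that strand. The
  calculation slides \<open>c'\<close> to the front, past \<open>c\<close>, until the bent strand appears tensored with
  \<open>w\<close>.\<close>
lemma coev_mate:
  assumes "zigzag x y c e" "w \<in> Ob T" "arr T c'" "src c' = I" "tgt c' = x \<otimes> w"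
  shows "c \<cdot> (\<iota> x \<star> mate x y w c' e) = c'"
proof -
  have [simp]: "x \<in> Ob T" "y \<in> Ob T" "w \<in> Ob T" "arr T c" "src c = I" "tgt c = x \<otimes> y"
     "arr T e" "src e = y \<otimes> x" "tgt e = I" "arr T c'" "src c' = I" "tgt c' = x \<otimes> w"
    and zz: "lun' x \<cdot> (c \<star> \<iota> x) \<cdot> \<alpha> x y x \<cdot> (\<iota> x \<star> e) \<cdot> run x = \<iota> x"
    using assms by (auto simp: zigzag_def dual_shape_def)
  have "c \<cdot> (\<iota> x \<star> mate x y w c' e)
      = c \<cdot> run' (x \<otimes> y) \<cdot> (\<alpha> x y I \<cdot> (\<iota> x \<star> (\<iota> y \<star> c')))
      \<cdot> (\<iota> x \<star> \<alpha>' y x w) \<cdot> (\<iota> x \<star> (e \<star> \<iota> w)) \<cdot> (\<iota> x \<star> lun w)"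
    by (simp add: mate_def whisker_left_seq run'_tensor[symmetric] seq_assoc)
  also have "\<dots> = (c \<cdot> run' (x \<otimes> y)) \<cdot> (\<iota> (x \<otimes> y) \<star> c') \<cdot> (\<alpha> x y (x \<otimes> w) \<cdot> (\<iota> x \<star> \<alpha>' y x w))
      \<cdot> (\<iota> x \<star> (e \<star> \<iota> w)) \<cdot> (\<iota> x \<star> lun w)"
    using \<alpha>_nat[of "\<iota> x" "\<iota> y" c'] by (simp add: seq_assoc[symmetric])
  also have "\<dots> = run' I \<cdot> ((c \<star> \<iota> I) \<cdot> (\<iota> (x \<otimes> y) \<star> c')) \<cdot> \<alpha>' (x \<otimes> y) x w \<cdot> (\<alpha> x y x \<star> \<iota> w)
      \<cdot> (\<alpha> x (y \<otimes> x) w \<cdot> (\<iota> x \<star> (e \<star> \<iota> w))) \<cdot> (\<iota> x \<star> lun w)"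
    using run'_nat[of c] by (simp add: pentagon_mixed seq_assoc)
  also have "\<dots> = (lun' I \<cdot> (\<iota> I \<star> c')) \<cdot> ((c \<star> (\<iota> x \<star> \<iota> w)) \<cdot> \<alpha>' (x \<otimes> y) x w) \<cdot> (\<alpha> x y x \<star> \<iota> w)
      \<cdot> ((\<iota> x \<star> e) \<star> \<iota> w) \<cdot> \<alpha> x I w \<cdot> (\<iota> x \<star> lun w)"
    using whisker_exchange[of c c'] \<alpha>_nat[of "\<iota> x" e "\<iota> w", THEN seq_extend, of "\<iota> x \<star> lun w"]
    by (simp add: lun'_unit_eq_run'_unit seq_assoc seq_assoc[of "\<iota> I \<star> c'", symmetric])
  also have "\<dots> = c' \<cdot> (lun' (x \<otimes> w) \<cdot> \<alpha>' I x w) \<cdot> ((c \<star> \<iota> x) \<star> \<iota> w) \<cdot> (\<alpha> x y x \<star> \<iota> w)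
      \<cdot> ((\<iota> x \<star> e) \<star> \<iota> w) \<cdot> (run x \<star> \<iota> w)"
    using lun'_nat[of c', symmetric] \<alpha>'_nat[of c "\<iota> x" "\<iota> w"] by (simp add: triangle_arrow seq_assoc)
  also have "\<dots> = c' \<cdot> ((lun' x \<cdot> (c \<star> \<iota> x) \<cdot> \<alpha> x y x \<cdot> (\<iota> x \<star> e) \<cdot> run x) \<star> \<iota> w)"
    by (simp add: lun'_tensor whisker_right_seq)
  finally show ?thesis by (simp add: zz)
qed

text \<open>The same argument upside down: \<open>e\<close> slides to the end, and the strand that is straightened runs
  through \<open>c'\<close> and \<open>e'\<close>, so this time the triangle identity for \<open>(x, w)\<close> is used.\<close>
lemma mate_ev:
  assumes "zigzag x w c' e'" "y \<in> Ob T" "arr T e" "src e = y \<otimes> x" "tgt e = I"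
  shows "(mate x y w c' e \<star> \<iota> x) \<cdot> e' = e"
proof -
  have [simp]: "x \<in> Ob T" "y \<in> Ob T" "w \<in> Ob T" "arr T c'" "src c' = I" "tgt c' = x \<otimes> w"
     "arr T e'" "src e' = w \<otimes> x" "tgt e' = I" "arr T e" "src e = y \<otimes> x" "tgt e = I"
    and zz: "lun' x \<cdot> (c' \<star> \<iota> x) \<cdot> \<alpha> x w x \<cdot> (\<iota> x \<star> e') \<cdot> run x = \<iota> x"
    using assms by (auto simp: zigzag_def dual_shape_def)
  have "(mate x y w c' e \<star> \<iota> x) \<cdot> e'
      = (run' y \<star> \<iota> x) \<cdot> ((\<iota> y \<star> c') \<star> \<iota> x) \<cdot> (\<alpha>' y x w \<star> \<iota> x)
      \<cdot> ((e \<star> \<iota> w) \<star> \<iota> x) \<cdot> \<alpha> I w x \<cdot> lun (w \<otimes> x) \<cdot> e'"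
    by (simp add: mate_def whisker_right_seq lun_tensor[symmetric] seq_assoc)
  also have "\<dots> = (run' y \<star> \<iota> x) \<cdot> ((\<iota> y \<star> c') \<star> \<iota> x) \<cdot> (\<alpha>' y x w \<star> \<iota> x)
      \<cdot> (((e \<star> \<iota> w) \<star> \<iota> x) \<cdot> \<alpha> I w x) \<cdot> (\<iota> I \<star> e') \<cdot> run I"
    using lun_nat[of e'] by (simp add: lun_unit_eq_run_unit seq_assoc)
  also have "\<dots> = (run' y \<star> \<iota> x) \<cdot> ((\<iota> y \<star> c') \<star> \<iota> x) \<cdot> ((\<alpha>' y x w \<star> \<iota> x) \<cdot> \<alpha> (y \<otimes> x) w x)
      \<cdot> ((e \<star> \<iota> (w \<otimes> x)) \<cdot> (\<iota> I \<star> e')) \<cdot> run I"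
    using \<alpha>_nat[of e "\<iota> w" "\<iota> x"] by (simp add: seq_assoc)
  also have "\<dots> = (run' y \<star> \<iota> x) \<cdot> (((\<iota> y \<star> c') \<star> \<iota> x) \<cdot> \<alpha> y (x \<otimes> w) x) \<cdot> (\<iota> y \<star> \<alpha> x w x)
      \<cdot> (\<alpha>' y x (w \<otimes> x) \<cdot> (\<iota> (y \<otimes> x) \<star> e')) \<cdot> ((e \<star> \<iota> I) \<cdot> run I)"
    using whisker_exchange[of e e']
    by (simp add: pentagon_mixed' seq_assoc seq_assoc[of "\<iota> (y \<otimes> x) \<star> e'", symmetric])
  also have "\<dots> = ((run' y \<star> \<iota> x) \<cdot> \<alpha> y I x) \<cdot> (\<iota> y \<star> (c' \<star> \<iota> x)) \<cdot> (\<iota> y \<star> \<alpha> x w x)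
      \<cdot> (\<iota> y \<star> (\<iota> x \<star> e')) \<cdot> (\<alpha>' y x I \<cdot> run (y \<otimes> x)) \<cdot> e"
    using \<alpha>_nat[of "\<iota> y" c' "\<iota> x"] \<alpha>'_nat[of "\<iota> y" "\<iota> x" e', THEN seq_extend, of "run (y \<otimes> x) \<cdot> e"] run_nat[of e]
    by (simp add: seq_assoc)
  also have "\<dots> = (\<iota> y \<star> (lun' x \<cdot> (c' \<star> \<iota> x) \<cdot> \<alpha> x w x \<cdot> (\<iota> x \<star> e') \<cdot> run x)) \<cdot> e"
    by (simp add: triangle' run_tensor' whisker_left_seq seq_assoc)
  finally show ?thesis by (simp add: zz)
qed

text \<open>Up to coherence both sides are \<open>c \<otimes> d\<close> followed by the associators from
  \<open>(m' \<otimes> m) \<otimes> (n \<otimes> n')\<close> to \<open>m' \<otimes> ((m \<otimes> n) \<otimes> n')\<close>. On the left \<open>d\<close> is created first and \<open>c\<close> is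
  inserted before \<open>n\<close>; on the right \<open>c\<close> is created first and \<open>d\<close> is inserted after \<open>m\<close>. Interchange of \<open>c\<close>
  and \<open>d\<close> passes from one to the other, with the two unitors of \<open>I\<close> being equal.\<close>
lemma coev_slide:
  assumes [simp]: "m' \<in> Ob T" "m \<in> Ob T" "n \<in> Ob T" "n' \<in> Ob T"
    and [simp]: "arr T c" "src c = I" "tgt c = m' \<otimes> m" "arr T d" "src d = I" "tgt d = n \<otimes> n'"
  shows "d \<cdot> ((lun' n \<cdot> (c \<star> \<iota> n) \<cdot> \<alpha> m' m n) \<star> \<iota> n') \<cdot> \<alpha> m' (m \<otimes> n) n'
    = c \<cdot> (\<iota> m' \<star> (run' m \<cdot> (\<iota> m \<star> d) \<cdot> \<alpha>' m n n'))"
    (is "?lhs = ?rhs")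
proof -
  let ?z = "\<alpha> m' m (n \<otimes> n') \<cdot> (\<iota> m' \<star> \<alpha>' m n n')"
  have "?lhs = d \<cdot> lun' (n \<otimes> n') \<cdot> (\<alpha>' I n n' \<cdot> ((c \<star> \<iota> n) \<star> \<iota> n')) \<cdot> (\<alpha> m' m n \<star> \<iota> n') \<cdot> \<alpha> m' (m \<otimes> n) n'"
    by (simp add: whisker_right_seq lun'_tensor[symmetric] seq_assoc)
  also have "\<dots> = (d \<cdot> lun' (n \<otimes> n')) \<cdot> (c \<star> \<iota> (n \<otimes> n')) \<cdot> ?z"
    using \<alpha>'_nat[of c "\<iota> n" "\<iota> n'", symmetric] by (simp add: pentagon_mixed seq_assoc)
  also have "\<dots> = lun' I \<cdot> ((\<iota> I \<star> d) \<cdot> (c \<star> \<iota> (n \<otimes> n'))) \<cdot> ?z"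
    using lun'_nat[of d] by (simp add: seq_assoc)
  also have "\<dots> = run' I \<cdot> ((c \<star> \<iota> I) \<cdot> (\<iota> (m' \<otimes> m) \<star> d)) \<cdot> ?z"
    using whisker_exchange[of c d] by (simp add: lun'_unit_eq_run'_unit)
  also have "\<dots> = c \<cdot> run' (m' \<otimes> m) \<cdot> (\<iota> (m' \<otimes> m) \<star> d) \<cdot> ?z"
    using run'_nat[of c, THEN seq_extend, of "(\<iota> (m' \<otimes> m) \<star> d) \<cdot> ?z"] by (simp add: seq_assoc)
  also have "\<dots> = c \<cdot> (run' (m' \<otimes> m) \<cdot> \<alpha> m' m I) \<cdot> (\<iota> m' \<star> (\<iota> m \<star> d)) \<cdot> (\<iota> m' \<star> \<alpha>' m n n')"
    using \<alpha>_nat[of "\<iota> m'" "\<iota> m" d, THEN seq_extend, of "\<iota> m' \<star> \<alpha>' m n n'"] by (simp add: seq_assoc)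
  also have "\<dots> = ?rhs"
    by (simp add: run'_tensor whisker_left_seq)
  finally show ?thesis .
qed

text \<open>The counterpart for evaluations: both sides are the associators from \<open>(n' \<otimes> (n \<otimes> m)) \<otimes> m'\<close>
  to \<open>(n' \<otimes> n) \<otimes> (m \<otimes> m')\<close> followed by \<open>e \<otimes> f\<close>, again up to interchange and the equality of
  the unitors of \<open>I\<close>.\<close>
lemma ev_slide:
  assumes [simp]: "m' \<in> Ob T" "m \<in> Ob T" "n \<in> Ob T" "n' \<in> Ob T"
    and [simp]: "arr T f" "src f = m \<otimes> m'" "tgt f = I" "arr T e" "src e = n' \<otimes> n" "tgt e = I"
  shows "\<alpha> n' (n \<otimes> m) m' \<cdot> (\<iota> n' \<star> (\<alpha> n m m' \<cdot> (\<iota> n \<star> f) \<cdot> run n)) \<cdot> e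
    = ((\<alpha>' n' n m \<cdot> (e \<star> \<iota> m) \<cdot> lun m) \<star> \<iota> m') \<cdot> f"
    (is "?lhs = ?rhs")
proof -
  let ?z = "(\<alpha>' n' n m \<star> \<iota> m') \<cdot> \<alpha> (n' \<otimes> n) m m'"
  have z: "\<alpha> n' (n \<otimes> m) m' \<cdot> (\<iota> n' \<star> \<alpha> n m m') = ?z \<cdot> \<alpha> n' n (m \<otimes> m')"
    by (simp add: pentagon_mixed' seq_assoc)
  have "?lhs = (\<alpha> n' (n \<otimes> m) m' \<cdot> (\<iota> n' \<star> \<alpha> n m m')) \<cdot> (\<iota> n' \<star> (\<iota> n \<star> f)) \<cdot> (\<iota> n' \<star> run n) \<cdot> e"
    by (simp add: whisker_left_seq seq_assoc)
  also have "\<dots> = ?z \<cdot> (\<alpha> n' n (m \<otimes> m') \<cdot> (\<iota> n' \<star> (\<iota> n \<star> f))) \<cdot> (\<iota> n' \<star> run n) \<cdot> e"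
    unfolding z by (simp add: seq_assoc)
  also have "\<dots> = ?z \<cdot> (\<iota> (n' \<otimes> n) \<star> f) \<cdot> (\<alpha> n' n I \<cdot> (\<iota> n' \<star> run n)) \<cdot> e"
    using \<alpha>_nat[of "\<iota> n'" "\<iota> n" f, symmetric] by (simp add: seq_assoc)
  also have "\<dots> = ?z \<cdot> ((\<iota> (n' \<otimes> n) \<star> f) \<cdot> (e \<star> \<iota> I)) \<cdot> run I"
    using run_nat[of e] by (simp add: run_tensor seq_assoc)
  also have "\<dots> = ?z \<cdot> ((e \<star> \<iota> (m \<otimes> m')) \<cdot> (\<iota> I \<star> f)) \<cdot> lun I"
    using whisker_exchange[of e f] by (simp add: lun_unit_eq_run_unit)
  also have "\<dots> = (\<alpha>' n' n m \<star> \<iota> m') \<cdot> (\<alpha> (n' \<otimes> n) m m' \<cdot> (e \<star> \<iota> (m \<otimes> m'))) \<cdot> lun (m \<otimes> m') \<cdot> f"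
    using lun_nat[of f] by (simp add: seq_assoc)
  also have "\<dots> = (\<alpha>' n' n m \<star> \<iota> m') \<cdot> ((e \<star> \<iota> m) \<star> \<iota> m') \<cdot> (\<alpha> I m m' \<cdot> lun (m \<otimes> m')) \<cdot> f"
    using \<alpha>_nat[of e "\<iota> m" "\<iota> m'", THEN seq_extend, of "lun (m \<otimes> m') \<cdot> f"] by (simp add: seq_assoc)
  also have "\<dots> = ?rhs"
    by (simp add: lun_tensor whisker_right_seq seq_assoc)
  finally show ?thesis .
qed

end

section \<open>Symmetry and traces\<close>

context symmetric_monoidal_category
begin

definition "\<sigma> x y = Arr (x \<otimes> y) (Sym T x y) (y \<otimes> x)"

lemma \<sigma>_sels [simp]: "src (\<sigma> x y) = x \<otimes> y" "tgt (\<sigma> x y) = y \<otimes> x" "cell (\<sigma> x y) = Sym T x y"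
  by (simp_all add: \<sigma>_def)

lemma arr_\<sigma> [simp]: "\<lbrakk>x \<in> Ob T; y \<in> Ob T\<rbrakk> \<Longrightarrow> arr T (\<sigma> x y)"
  by (simp add: \<sigma>_def sym_hom)

lemma \<sigma>_\<sigma> [simp]: "\<lbrakk>x \<in> Ob T; y \<in> Ob T\<rbrakk> \<Longrightarrow> \<sigma> x y \<cdot> \<sigma> y x = \<iota> (x \<otimes> y)"
  by (rule arrow_eqI[of T]) (auto simp: sym_sym)

lemma \<sigma>_\<sigma>_extend [simp]: "\<lbrakk>x \<in> Ob T; y \<in> Ob T; arr T s; src s = x \<otimes> y\<rbrakk> \<Longrightarrow> \<sigma> x y \<cdot> \<sigma> y x \<cdot> s = s"
  by (simp add: seq_assoc[symmetric])

lemma \<sigma>_nat: "(s \<star> t) \<cdot> \<sigma> (tgt s) (tgt t) = \<sigma> (src s) (src t) \<cdot> (t \<star> s)"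
proof (cases "arr T s \<and> arr T t")
  case True
  then show ?thesis by (intro arrow_eqI[of T]) (auto simp: arr_cell intro!: sym_nat)
qed (auto simp: tns_def)

lemma hexagon_arrow: "\<lbrakk>x \<in> Ob T; y \<in> Ob T; z \<in> Ob T\<rbrakk> \<Longrightarrow>
    \<alpha> x y z \<cdot> \<sigma> x (y \<otimes> z) \<cdot> \<alpha> y z x = (\<sigma> x y \<star> \<iota> z) \<cdot> \<alpha> y x z \<cdot> (\<iota> y \<star> \<sigma> x z)"
  unfolding seq_assoc[symmetric] by (rule arrow_eqI[of T]) (auto simp: hexagon)

text \<open>The hexagon with two unit objects, simplified by naturality of the symmetry and of the left
  unitor, says that both sides agree after tensoring with \<open>I\<close> and composing with an invertible
  arrow (Joyal and Street).\<close>
lemma \<sigma>_unit: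
  assumes [simp]: "x \<in> Ob T"
  shows "\<sigma> x I \<cdot> lun x = run x"
proof -
  have "(run x \<star> \<iota> I) \<cdot> \<sigma> x I \<cdot> lun x = \<alpha> x I I \<cdot> ((\<iota> x \<star> lun I) \<cdot> \<sigma> x I) \<cdot> lun x"
    by (simp add: triangle_arrow[symmetric] seq_assoc)
  also have "\<dots> = \<alpha> x I I \<cdot> \<sigma> x (I \<otimes> I) \<cdot> \<alpha> I I x \<cdot> lun (I \<otimes> x) \<cdot> lun x"
    using \<sigma>_nat[of "\<iota> x" "lun I"] lun_tensor[of I x, THEN seq_extend, of "lun x"] by (simp add: seq_assoc)
  also have "\<dots> = (\<alpha> x I I \<cdot> \<sigma> x (I \<otimes> I) \<cdot> \<alpha> I I x) \<cdot> lun (I \<otimes> x) \<cdot> lun x"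
    by (simp add: seq_assoc)
  also have "\<dots> = (\<sigma> x I \<star> \<iota> I) \<cdot> \<alpha> I x I \<cdot> ((\<iota> I \<star> \<sigma> x I) \<cdot> lun (I \<otimes> x)) \<cdot> lun x"
    by (simp add: hexagon_arrow seq_assoc)
  also have "\<dots> = (\<sigma> x I \<star> \<iota> I) \<cdot> (\<alpha> I x I \<cdot> lun (x \<otimes> I)) \<cdot> \<sigma> x I \<cdot> lun x"
    using lun_nat[of "\<sigma> x I"] by (simp add: seq_assoc)
  also have "\<dots> = ((\<sigma> x I \<cdot> lun x) \<star> \<iota> I) \<cdot> \<sigma> x I \<cdot> lun x"
    by (simp add: lun_tensor whisker_right_seq seq_assoc)
  finally have "run x \<star> \<iota> I = (\<sigma> x I \<cdot> lun x) \<star> \<iota> I"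
    by (rule cancel_right[where q="lun' x \<cdot> \<sigma> I x" and x="x \<otimes> I"]) (simp_all add: seq_assoc inverse_cancel)
  then show ?thesis
    by (rule unit_whisker_right_faithful[symmetric]) simp_all
qed

lemma \<sigma>_unit': "x \<in> Ob T \<Longrightarrow> \<sigma> I x \<cdot> run x = lun x"
  by (simp add: \<sigma>_unit[symmetric])

lemma \<sigma>_unit_inv:
  assumes [simp]: "x \<in> Ob T"
  shows "run' x \<cdot> \<sigma> x I = lun' x"
proof -
  have "run' x \<cdot> \<sigma> x I = run' x \<cdot> (\<sigma> x I \<cdot> lun x) \<cdot> lun' x"
    by (simp add: seq_assoc)
  then show ?thesis
    by (simp add: \<sigma>_unit inverse_cancel)
qed

lemma \<sigma>_unit_inv': "x \<in> Ob T \<Longrightarrow> lun' x \<cdot> \<sigma> I x = run' x"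
  by (simp add: \<sigma>_unit_inv[symmetric] seq_assoc)

lemma hexagon_left:
  assumes [simp]: "x \<in> Ob T" "y \<in> Ob T" "z \<in> Ob T"
  shows "\<sigma> x (y \<otimes> z) \<cdot> \<alpha> y z x = \<alpha>' x y z \<cdot> (\<sigma> x y \<star> \<iota> z) \<cdot> \<alpha> y x z \<cdot> (\<iota> y \<star> \<sigma> x z)"
  by (simp add: hexagon_arrow[symmetric] inverse_cancel)

text \<open>The other hexagon. Because the symmetry is its own inverse, the given hexagon for \<open>z, x, y\<close>
  provides an inverse of the right-hand side.\<close>
lemma hexagon_right:
  assumes [simp]: "x \<in> Ob T" "y \<in> Ob T" "z \<in> Ob T"
  shows "\<alpha>' x y z \<cdot> \<sigma> (x \<otimes> y) z = (\<iota> x \<star> \<sigma> y z) \<cdot> \<alpha>' x z y \<cdot> (\<sigma> x z \<star> \<iota> y) \<cdot> \<alpha> z x y"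
proof (rule inverse_unique[of "\<sigma> z (x \<otimes> y) \<cdot> \<alpha> x y z" _ "z \<otimes> (x \<otimes> y)" _ "x \<otimes> (y \<otimes> z)"])
  show "(\<sigma> z (x \<otimes> y) \<cdot> \<alpha> x y z) \<cdot> \<alpha>' x y z \<cdot> \<sigma> (x \<otimes> y) z = \<iota> (z \<otimes> (x \<otimes> y))"
    by (simp add: seq_assoc inverse_cancel)
  show "((\<iota> x \<star> \<sigma> y z) \<cdot> \<alpha>' x z y \<cdot> (\<sigma> x z \<star> \<iota> y) \<cdot> \<alpha> z x y) \<cdot> \<sigma> z (x \<otimes> y) \<cdot> \<alpha> x y z = \<iota> (x \<otimes> (y \<otimes> z))"
    unfolding hexagon_left[of z x y, simplified]
    by (simp add: seq_assoc inverse_cancel)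
qed simp_all

text \<open>Reversing the order of three factors: both sides lead from \<open>a \<otimes> (b \<otimes> c)\<close> to
  \<open>c \<otimes> (a \<otimes> b)\<close>. On the left \<open>a\<close> and \<open>b\<close> are interchanged twice, once as part of the
  first symmetry and once by the last.\<close>
lemma braid_left:
  assumes [simp]: "a \<in> Ob T" "b \<in> Ob T" "c \<in> Ob T"
  shows "\<sigma> a (b \<otimes> c) \<cdot> (\<sigma> b c \<star> \<iota> a) \<cdot> \<alpha> c b a \<cdot> (\<iota> c \<star> \<sigma> b a) = \<alpha>' a b c \<cdot> \<sigma> (a \<otimes> b) c"
proof -
  have "\<sigma> a (b \<otimes> c) \<cdot> (\<sigma> b c \<star> \<iota> a) \<cdot> \<alpha> c b a \<cdot> (\<iota> c \<star> \<sigma> b a)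
      = (\<iota> a \<star> \<sigma> b c) \<cdot> (\<sigma> a (c \<otimes> b) \<cdot> \<alpha> c b a) \<cdot> (\<iota> c \<star> \<sigma> b a)"
    using \<sigma>_nat[of "\<iota> a" "\<sigma> b c", THEN seq_extend, of "\<alpha> c b a \<cdot> (\<iota> c \<star> \<sigma> b a)"] by (simp add: seq_assoc)
  also have "\<dots> = (\<iota> a \<star> \<sigma> b c) \<cdot> \<alpha>' a c b \<cdot> (\<sigma> a c \<star> \<iota> b) \<cdot> \<alpha> c a b"
    by (simp add: hexagon_left seq_assoc)
  finally show ?thesis by (simp add: hexagon_right)
qed

text \<open>Obtained from \<open>braid_left\<close> by taking inverses.\<close>
lemma braid_right:
  assumes [simp]: "a \<in> Ob T" "b \<in> Ob T" "c \<in> Ob T"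
  shows "\<sigma> (a \<otimes> b) c \<cdot> (\<iota> c \<star> \<sigma> a b) \<cdot> \<alpha>' c b a \<cdot> (\<sigma> c b \<star> \<iota> a) = \<alpha> a b c \<cdot> \<sigma> a (b \<otimes> c)"
proof (rule inverse_unique[of "\<sigma> (b \<otimes> c) a \<cdot> \<alpha>' a b c" _ "(b \<otimes> c) \<otimes> a" _ "(a \<otimes> b) \<otimes> c", symmetric])
  show "(\<sigma> (b \<otimes> c) a \<cdot> \<alpha>' a b c) \<cdot> \<alpha> a b c \<cdot> \<sigma> a (b \<otimes> c) = \<iota> ((b \<otimes> c) \<otimes> a)"
    by (simp add: seq_assoc inverse_cancel)
  have "\<alpha>' a b c = \<sigma> a (b \<otimes> c) \<cdot> (\<sigma> b c \<star> \<iota> a) \<cdot> \<alpha> c b a \<cdot> (\<iota> c \<star> \<sigma> b a) \<cdot> \<sigma> c (a \<otimes> b)"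
    using braid_left[of a b c, THEN seq_extend, of "\<sigma> c (a \<otimes> b)"] by (simp add: seq_assoc)
  then show "(\<sigma> (a \<otimes> b) c \<cdot> (\<iota> c \<star> \<sigma> a b) \<cdot> \<alpha>' c b a \<cdot> (\<sigma> c b \<star> \<iota> a)) \<cdot> \<sigma> (b \<otimes> c) a \<cdot> \<alpha>' a b c
      = \<iota> ((a \<otimes> b) \<otimes> c)"
    by (simp add: seq_assoc inverse_cancel)
qed simp_all

text \<open>In a symmetric category a dual can be put on either side. The two symmetries next to \<open>c\<close>
  and \<open>e\<close>, together with the one that carries \<open>c\<close> past \<open>y\<close>, combine by \<open>braid_left\<close> to a single
  symmetry, which is then absorbed into the unitor after \<open>e\<close> by naturality.\<close>
lemma zigzag_swap:
  assumes "zagzig x y c e"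
  shows "zigzag y x (c \<cdot> \<sigma> x y) (\<sigma> x y \<cdot> e)"
proof -
  have [simp]: "x \<in> Ob T" "y \<in> Ob T" "arr T c" "src c = I" "tgt c = x \<otimes> y"
     "arr T e" "src e = y \<otimes> x" "tgt e = I"
    and zz: "run' y \<cdot> (\<iota> y \<star> c) \<cdot> \<alpha>' y x y \<cdot> (e \<star> \<iota> y) \<cdot> lun y = \<iota> y"
    using assms by (auto simp: zagzig_def dual_shape_def)
  have "lun' y \<cdot> ((c \<cdot> \<sigma> x y) \<star> \<iota> y) \<cdot> \<alpha> y x y \<cdot> (\<iota> y \<star> (\<sigma> x y \<cdot> e)) \<cdot> run y
      = run' y \<cdot> (\<sigma> y I \<cdot> (c \<star> \<iota> y)) \<cdot> (\<sigma> x y \<star> \<iota> y) \<cdot> \<alpha> y x y \<cdot> (\<iota> y \<star> \<sigma> x y) \<cdot> (\<iota> y \<star> e) \<cdot> run y"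
    by (simp add: \<sigma>_unit_inv[symmetric] whisker_right_seq whisker_left_seq seq_assoc)
  also have "\<dots> = run' y \<cdot> (\<iota> y \<star> c) \<cdot> (\<sigma> y (x \<otimes> y) \<cdot> (\<sigma> x y \<star> \<iota> y) \<cdot> \<alpha> y x y \<cdot> (\<iota> y \<star> \<sigma> x y)) \<cdot> (\<iota> y \<star> e) \<cdot> run y"
    using \<sigma>_nat[of "\<iota> y" c, symmetric] by (simp add: seq_assoc)
  also have "\<dots> = run' y \<cdot> (\<iota> y \<star> c) \<cdot> \<alpha>' y x y \<cdot> (\<sigma> (y \<otimes> x) y \<cdot> (\<iota> y \<star> e)) \<cdot> run y"
    by (simp add: braid_left seq_assoc)
  also have "\<dots> = run' y \<cdot> (\<iota> y \<star> c) \<cdot> \<alpha>' y x y \<cdot> (e \<star> \<iota> y) \<cdot> lun y"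
    using \<sigma>_nat[of e "\<iota> y", symmetric] by (simp add: \<sigma>_unit' seq_assoc)
  finally show ?thesis
    by (simp add: zz zigzag_def dual_shape_def)
qed

lemma zagzig_swap:
  assumes "zigzag x y c e"
  shows "zagzig y x (c \<cdot> \<sigma> x y) (\<sigma> x y \<cdot> e)"
proof -
  have [simp]: "x \<in> Ob T" "y \<in> Ob T" "arr T c" "src c = I" "tgt c = x \<otimes> y"
     "arr T e" "src e = y \<otimes> x" "tgt e = I"
    and zz: "lun' x \<cdot> (c \<star> \<iota> x) \<cdot> \<alpha> x y x \<cdot> (\<iota> x \<star> e) \<cdot> run x = \<iota> x"
    using assms by (auto simp: zigzag_def dual_shape_def)
  have "run' x \<cdot> (\<iota> x \<star> (c \<cdot> \<sigma> x y)) \<cdot> \<alpha>' x y x \<cdot> ((\<sigma> x y \<cdot> e) \<star> \<iota> x) \<cdot> lun x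
      = lun' x \<cdot> (\<sigma> I x \<cdot> (\<iota> x \<star> c)) \<cdot> (\<iota> x \<star> \<sigma> x y) \<cdot> \<alpha>' x y x \<cdot> (\<sigma> x y \<star> \<iota> x) \<cdot> (e \<star> \<iota> x) \<cdot> lun x"
    by (simp add: \<sigma>_unit_inv'[symmetric] whisker_right_seq whisker_left_seq seq_assoc)
  also have "\<dots> = lun' x \<cdot> (c \<star> \<iota> x) \<cdot> (\<sigma> (x \<otimes> y) x \<cdot> (\<iota> x \<star> \<sigma> x y) \<cdot> \<alpha>' x y x \<cdot> (\<sigma> x y \<star> \<iota> x)) \<cdot> (e \<star> \<iota> x) \<cdot> lun x"
    using \<sigma>_nat[of c "\<iota> x", symmetric] by (simp add: seq_assoc)
  also have "\<dots> = lun' x \<cdot> (c \<star> \<iota> x) \<cdot> \<alpha> x y x \<cdot> (\<sigma> x (y \<otimes> x) \<cdot> (e \<star> \<iota> x)) \<cdot> lun x"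
    by (simp add: braid_right seq_assoc)
  also have "\<dots> = lun' x \<cdot> (c \<star> \<iota> x) \<cdot> \<alpha> x y x \<cdot> (\<iota> x \<star> e) \<cdot> run x"
    using \<sigma>_nat[of "\<iota> x" e, symmetric] by (simp add: \<sigma>_unit seq_assoc)
  finally show ?thesis
    by (simp add: zz zagzig_def dual_shape_def)
qed

definition trace :: "'x \<Rightarrow> 'x \<Rightarrow> ('x, 'f) arrow \<Rightarrow> ('x, 'f) arrow \<Rightarrow> ('x, 'f) arrow \<Rightarrow> ('x, 'f) arrow" where
  "trace x y c e h = c \<cdot> (h \<star> \<iota> y) \<cdot> \<sigma> x y \<cdot> e"

lemma cell_trace:
  assumes "mon_dual_pair x y c e" "arr T h" "src h = x" "tgt h = x"
  shows "cell (trace x y (Arr I c (x \<otimes> y)) (Arr (y \<otimes> x) e I) h) = mon_trace T x y c e (cell h)"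
  using assms by (simp add: trace_def mon_trace_def mon_dual_pair_def seq_assoc[symmetric])

text \<open>With \<open>k\<close> the comparison between the two duals, \<open>c' = c (x \<otimes> k)\<close> and \<open>e = (k \<otimes> x) e'\<close>. So
  \<open>k\<close> appears next to \<open>e'\<close> in one trace and next to \<open>c\<close> in the other, and it can be slid along the
  strand of the dual from one place to the other.\<close>
lemma trace_dual_unique:
  assumes d: "zigzag x y c e" and d': "zigzag x w c' e'"
    and [simp]: "arr T h" "src h = x" "tgt h = x"
  shows "trace x y c e h = trace x w c' e' h"
proof -
  have [simp]: "x \<in> Ob T" "y \<in> Ob T" "w \<in> Ob T" "arr T c" "src c = I" "tgt c = x \<otimes> y"
     "arr T e" "src e = y \<otimes> x" "tgt e = I" "arr T c'" "src c' = I" "tgt c' = x \<otimes> w"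
     "arr T e'" "src e' = w \<otimes> x" "tgt e' = I"
    using d d' by (auto simp: zigzag_def dual_shape_def)
  \<comment> \<open>slides from \<open>e'\<close> back to \<open>c\<close>\<close>
  define k where "k = mate x y w c' e"
  have [simp]: "arr T k" "src k = y" "tgt k = w"
    by (simp_all add: k_def mate_def)
  have c': "c \<cdot> (\<iota> x \<star> k) = c'" and e: "(k \<star> \<iota> x) \<cdot> e' = e"
    using coev_mate[OF d, of w c'] mate_ev[OF d', of y e] by (simp_all add: k_def)
  have "trace x y c e h = c \<cdot> (h \<star> \<iota> y) \<cdot> (\<sigma> x y \<cdot> (k \<star> \<iota> x)) \<cdot> e'"
    by (simp add: trace_def e[symmetric] seq_assoc)
  also have "\<dots> = c \<cdot> ((h \<star> \<iota> y) \<cdot> (\<iota> x \<star> k)) \<cdot> \<sigma> x w \<cdot> e'"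
    using \<sigma>_nat[of "\<iota> x" k, symmetric] by (simp add: seq_assoc)
  also have "(h \<star> \<iota> y) \<cdot> (\<iota> x \<star> k) = (\<iota> x \<star> k) \<cdot> (h \<star> \<iota> w)"
    using whisker_exchange[of h k] by simp
  also have "c \<cdot> ((\<iota> x \<star> k) \<cdot> (h \<star> \<iota> w)) \<cdot> \<sigma> x w \<cdot> e' = trace x w c' e' h"
    by (simp add: trace_def c'[symmetric] seq_assoc)
  finally show ?thesis .
qed

text \<open>By naturality \<open>h\<close> passes the symmetry next to \<open>c\<close>, and then two of the three symmetries in
  the trace cancel.\<close>
lemma trace_swap:
  assumes "dual_shape x y c e" "arr T h" "src h = y" "tgt h = y"
  shows "trace y x (c \<cdot> \<sigma> x y) (\<sigma> x y \<cdot> e) h = c \<cdot> (\<iota> x \<star> h) \<cdot> \<sigma> x y \<cdot> e"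
proof -
  have [simp]: "x \<in> Ob T" "y \<in> Ob T" "arr T c" "src c = I" "tgt c = x \<otimes> y"
     "arr T e" "src e = y \<otimes> x" "tgt e = I" "arr T h" "src h = y" "tgt h = y"
    using assms by (auto simp: dual_shape_def)
  show ?thesis
    using \<sigma>_nat[of "\<iota> x" h, THEN seq_extend, of "\<sigma> y x \<cdot> \<sigma> x y \<cdot> e"]
    by (simp add: trace_def seq_assoc)
qed

lemma dual_arrows_swap: "dual_arrows x y c e \<Longrightarrow> dual_arrows y x (c \<cdot> \<sigma> x y) (\<sigma> x y \<cdot> e)"
  by (simp add: dual_arrows_def zigzag_swap zagzig_swap)

end

section \<open>Functors on arrows and endomorphism categories\<close>

definition fun_arrow :: "('x, 'f, 'y, 'g) fun_data \<Rightarrow> ('x, 'f) arrow \<Rightarrow> ('y, 'g) arrow" where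
  "fun_arrow F t = (case t of Null \<Rightarrow> Null | Arr x f y \<Rightarrow> Arr (F \<cdot>\<^sub>o x) (F \<cdot>\<^sub>h f) (F \<cdot>\<^sub>o y))"

lemma fun_arrow_sels [simp]:
  assumes "arr C t"
  shows "src (fun_arrow F t) = F \<cdot>\<^sub>o src t" "tgt (fun_arrow F t) = F \<cdot>\<^sub>o tgt t"
    "cell (fun_arrow F t) = F \<cdot>\<^sub>h cell t"
  using assms by (cases t; simp add: fun_arrow_def)+

context cat_functor
begin

lemma arr_fun_arrow: "arr C t \<Longrightarrow> arr D (fun_arrow F t)"
  by (cases t) (auto simp: fun_arrow_def ob_map hom_map)

lemma fun_arrow_ident: "x \<in> Ob C \<Longrightarrow> fun_arrow F (ident C x) = ident D (F \<cdot>\<^sub>o x)"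
  by (simp add: fun_arrow_def ident_def map_idt)

lemma fun_arrow_seq:
  assumes "arr C s" "arr C t" "tgt s = src t"
  shows "fun_arrow F (seq C s t) = seq D (fun_arrow F s) (fun_arrow F t)"
proof (rule arrow_eqI[of D])
  show "cell (fun_arrow F (seq C s t)) = cell (seq D (fun_arrow F s) (fun_arrow F t))"
    using assms map_comp[of "src s" "src t" "tgt t" "cell s" "cell t"] arr_cell[of C s] arr_cell[of C t]
    by (simp add: fun_arrow_sels[of C] arr_fun_arrow)
qed (use assms in \<open>simp_all add: fun_arrow_sels[of C] arr_fun_arrow\<close>)

end

text \<open>A bicategory with one object is a monoidal category; \<open>End B A\<close> is the part of \<open>B\<close> over the
  0-cell \<open>A\<close> in this form.\<close>
definition End :: "('o, 'm, 'c, 'z) bicat_scheme \<Rightarrow> 'o \<Rightarrow> ('m, 'c) moncat" where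
  "End B A = \<lparr>Ob = Cell1 B A A, Hom = Cell2 B, Idt = Id2 B, Comp = VComp B,
     Tens = HComp1 B, TensH = HComp2 B, TUnit = BUnit B A, TAs = BAs B, TAsi = BAsi B,
     TLu = BLu B, TLui = BLui B, TRu = BRu B, TRui = BRui B\<rparr>"

lemma End_sels [simp]:
  "Ob (End B A) = Cell1 B A A" "Hom (End B A) = Cell2 B" "Idt (End B A) = Id2 B"
  "Comp (End B A) = VComp B" "Tens (End B A) = HComp1 B" "TensH (End B A) = HComp2 B"
  "TUnit (End B A) = BUnit B A" "TAs (End B A) = BAs B" "TAsi (End B A) = BAsi B"
  "TLu (End B A) = BLu B" "TLui (End B A) = BLui B" "TRu (End B A) = BRu B" "TRui (End B A) = BRui B"
  by (simp_all add: End_def)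

lemma (in bicategory) monoidal_category_End:
  assumes A: "A \<in> cell0"
  shows "monoidal_category (End B A)"
proof -
  have eq: "inverse_pair (End B A) x y f g = inverse_pair (HomCat B A A) x y f g" for x y f g
    by (simp add: inverse_pair_def HomCat_def)
  interpret H: category "HomCat B A A" by (rule homcat[OF A A])
  have sels: "Ob (HomCat B A A) = cell1 A A" "Hom (HomCat B A A) = cell2"
    "Idt (HomCat B A A) = id2" "Comp (HomCat B A A) = VComp B"
    by (simp_all add: HomCat_def)
  show ?thesis
    by unfold_locales
      (unfold eq End_sels,
       (rule H.idt_hom[unfolded sels] H.comp_hom[unfolded sels] H.idt_comp[unfolded sels]
          H.comp_idt[unfolded sels] H.comp_assoc[unfolded sels]
          hcomp_1[OF A A A] bunit_1[OF A] hcomp_2[OF A A A] hcomp_id[OF A A A]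
          interchange[OF A A A] bas_iso[OF A A A A] blu_iso[OF A A] bru_iso[OF A A]
          bas_nat[OF A A A A] blu_nat[OF A A] bru_nat[OF A A]
          bpentagon[OF A A A A A] btriangle[OF A A A]; assumption)+)
qed

lemma (in bicategory) cat_functor_End:
  assumes "cat_functor (HomCat B A A) T F" "A \<in> cell0"
  shows "cat_functor (End B A) T F"
proof -
  interpret F: cat_functor "HomCat B A A" T F by fact
  interpret V: monoidal_category "End B A" by (rule monoidal_category_End) fact
  have sels: "Ob (HomCat B A A) = cell1 A A" "Hom (HomCat B A A) = cell2"
    "Idt (HomCat B A A) = id2" "Comp (HomCat B A A) = VComp B"
    by (simp_all add: HomCat_def)
  show ?thesis
    by unfold_locales
      (unfold End_sels,
       (rule F.ob_map[unfolded sels] F.hom_map[unfolded sels] F.map_idt[unfolded sels]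
          F.map_comp[unfolded sels]; assumption)+)
qed

section \<open>Duality in a penumbra\<close>

text \<open>Duals and traces in a penumbra concern one 0-cell \<open>A\<close> at a time, so it is fixed here. The subscript
  \<open>V\<close> and the prefix \<open>V.\<close> mark operations of \<open>End B A\<close>; unmarked ones belong to \<open>T\<close>. Script letters
  denote the four functors on arrows, and Gothic letters, \<open>\<Lambda>\<close> and \<open>\<rho>\<close> the structure
  maps of the penumbra as arrows.\<close>
locale penumbra_at = penumbra +
  fixes A
  assumes A [simp]: "A \<in> cell0"
begin

sublocale V: monoidal_category "End B A"
  by (rule monoidal_category_End[OF A])
sublocale S: cat_functor "End B A" T S by (rule cat_functor_End[OF functor_S[OF A] A])
sublocale D: cat_functor "End B A" T D by (rule cat_functor_End[OF functor_D[OF A] A])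
sublocale C: cat_functor "End B A" T C by (rule cat_functor_End[OF functor_C[OF A] A])
sublocale E: cat_functor "End B A" T E by (rule cat_functor_End[OF functor_E[OF A] A])

abbreviation seq_V (infixr "\<cdot>\<^sub>V" 55) where "f \<cdot>\<^sub>V g \<equiv> seq (End B A) f g"
abbreviation tns_V (infixl "\<star>\<^sub>V" 70) where "f \<star>\<^sub>V g \<equiv> tns (End B A) f g"

abbreviation arrow_S ("\<S>") where "\<S> \<equiv> fun_arrow S"
abbreviation arrow_D ("\<D>") where "\<D> \<equiv> fun_arrow D"
abbreviation arrow_C ("\<C>") where "\<C> \<equiv> fun_arrow C"
abbreviation arrow_E ("\<E>") where "\<E> \<equiv> fun_arrow E"

definition "\<rr> M N = Arr (D \<cdot>\<^sub>o M \<otimes> C \<cdot>\<^sub>o N) (r M N) (D \<cdot>\<^sub>o (M \<odot> N))"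
definition "\<Lambda> M N = Arr (D \<cdot>\<^sub>o (M \<odot> N)) (lam M N) (E \<cdot>\<^sub>o M \<otimes> D \<cdot>\<^sub>o N)"
definition "\<uu> M N = Arr (D \<cdot>\<^sub>o M \<otimes> S \<cdot>\<^sub>o N) (u M N) (E \<cdot>\<^sub>o (M \<odot> N))"
definition "\<ss> M N = Arr (C \<cdot>\<^sub>o (M \<odot> N)) (s M N) (S \<cdot>\<^sub>o M \<otimes> D \<cdot>\<^sub>o N)"
definition "\<ll> M N = Arr (C \<cdot>\<^sub>o M \<otimes> S \<cdot>\<^sub>o N) (l M N) (S \<cdot>\<^sub>o (M \<odot> N))"
definition "\<rho> M N = Arr (S \<cdot>\<^sub>o (M \<odot> N)) (rho M N) (S \<cdot>\<^sub>o M \<otimes> E \<cdot>\<^sub>o N)"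
definition "\<ii> = Arr I (i A) (C \<cdot>\<^sub>o U A)"
definition "\<ee> = Arr (E \<cdot>\<^sub>o U A) (e A) I"

lemma cell1_closed [simp]:
  "\<lbrakk>M \<in> cell1 A A; N \<in> cell1 A A\<rbrakk> \<Longrightarrow> M \<odot> N \<in> cell1 A A" "U A \<in> cell1 A A"
  using hcomp_1[OF A A A] bunit_1[OF A] by auto

lemma ob_maps [simp]:
  assumes "M \<in> cell1 A A"
  shows "S \<cdot>\<^sub>o M \<in> Ob T" "D \<cdot>\<^sub>o M \<in> Ob T" "C \<cdot>\<^sub>o M \<in> Ob T" "E \<cdot>\<^sub>o M \<in> Ob T"
  using assms S.ob_map[of M] D.ob_map[of M] C.ob_map[of M] E.ob_map[of M] by simp_all

lemma arr_V_ob [simp]: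
  assumes "arr (End B A) f"
  shows "src f \<in> cell1 A A" "tgt f \<in> cell1 A A"
  using arr_src[OF assms] arr_tgt[OF assms] by simp_all

lemmas functor_arrow [simp] =
  S.arr_fun_arrow D.arr_fun_arrow C.arr_fun_arrow E.arr_fun_arrow
  fun_arrow_sels[of "End B A"]
  S.fun_arrow_ident[simplified] D.fun_arrow_ident[simplified]
  C.fun_arrow_ident[simplified] E.fun_arrow_ident[simplified]

lemmas functor_seq = S.fun_arrow_seq D.fun_arrow_seq C.fun_arrow_seq E.fun_arrow_seq

lemma penumbra_sels [simp]:
  "src (\<rr> M N) = D \<cdot>\<^sub>o M \<otimes> C \<cdot>\<^sub>o N" "tgt (\<rr> M N) = D \<cdot>\<^sub>o (M \<odot> N)" "cell (\<rr> M N) = r M N"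
  "src (\<Lambda> M N) = D \<cdot>\<^sub>o (M \<odot> N)" "tgt (\<Lambda> M N) = E \<cdot>\<^sub>o M \<otimes> D \<cdot>\<^sub>o N" "cell (\<Lambda> M N) = lam M N"
  "src (\<uu> M N) = D \<cdot>\<^sub>o M \<otimes> S \<cdot>\<^sub>o N" "tgt (\<uu> M N) = E \<cdot>\<^sub>o (M \<odot> N)" "cell (\<uu> M N) = u M N"
  "src (\<ss> M N) = C \<cdot>\<^sub>o (M \<odot> N)" "tgt (\<ss> M N) = S \<cdot>\<^sub>o M \<otimes> D \<cdot>\<^sub>o N" "cell (\<ss> M N) = s M N"
  "src (\<ll> M N) = C \<cdot>\<^sub>o M \<otimes> S \<cdot>\<^sub>o N" "tgt (\<ll> M N) = S \<cdot>\<^sub>o (M \<odot> N)" "cell (\<ll> M N) = l M N"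
  "src (\<rho> M N) = S \<cdot>\<^sub>o (M \<odot> N)" "tgt (\<rho> M N) = S \<cdot>\<^sub>o M \<otimes> E \<cdot>\<^sub>o N" "cell (\<rho> M N) = rho M N"
  "src \<ii> = I" "tgt \<ii> = C \<cdot>\<^sub>o U A" "cell \<ii> = i A"
  "src \<ee> = E \<cdot>\<^sub>o U A" "tgt \<ee> = I" "cell \<ee> = e A"
  by (simp_all add: \<rr>_def \<Lambda>_def \<uu>_def \<ss>_def \<ll>_def \<rho>_def \<ii>_def \<ee>_def)

lemma arr_penumbra [simp]:
  "\<lbrakk>M \<in> cell1 A A; N \<in> cell1 A A\<rbrakk> \<Longrightarrow> arr T (\<rr> M N)"
  "\<lbrakk>M \<in> cell1 A A; N \<in> cell1 A A\<rbrakk> \<Longrightarrow> arr T (\<Lambda> M N)"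
  "\<lbrakk>M \<in> cell1 A A; N \<in> cell1 A A\<rbrakk> \<Longrightarrow> arr T (\<uu> M N)"
  "\<lbrakk>M \<in> cell1 A A; N \<in> cell1 A A\<rbrakk> \<Longrightarrow> arr T (\<ss> M N)"
  "\<lbrakk>M \<in> cell1 A A; N \<in> cell1 A A\<rbrakk> \<Longrightarrow> arr T (\<ll> M N)"
  "\<lbrakk>M \<in> cell1 A A; N \<in> cell1 A A\<rbrakk> \<Longrightarrow> arr T (\<rho> M N)"
  "arr T \<ii>" "arr T \<ee>"
  by (simp_all add: \<rr>_def \<Lambda>_def \<uu>_def \<ss>_def \<ll>_def \<rho>_def \<ii>_def \<ee>_def
      r_hom[OF A] lam_hom[OF A] u_hom[OF A] s_hom[OF A] l_hom[OF A] rho_hom[OF A] i_hom[OF A] e_hom[OF A])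

lemma penumbra_nat:
  assumes "arr (End B A) f" "arr (End B A) g"
  shows \<rr>_nat: "(\<D> f \<star> \<C> g) \<cdot> \<rr> (tgt f) (tgt g) = \<rr> (src f) (src g) \<cdot> \<D> (f \<star>\<^sub>V g)"
    and \<Lambda>_nat: "\<D> (f \<star>\<^sub>V g) \<cdot> \<Lambda> (tgt f) (tgt g) = \<Lambda> (src f) (src g) \<cdot> (\<E> f \<star> \<D> g)"
    and \<uu>_nat: "(\<D> f \<star> \<S> g) \<cdot> \<uu> (tgt f) (tgt g) = \<uu> (src f) (src g) \<cdot> \<E> (f \<star>\<^sub>V g)"
    and \<ss>_nat: "\<C> (f \<star>\<^sub>V g) \<cdot> \<ss> (tgt f) (tgt g) = \<ss> (src f) (src g) \<cdot> (\<S> f \<star> \<D> g)"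
    and \<ll>_nat: "(\<C> f \<star> \<S> g) \<cdot> \<ll> (tgt f) (tgt g) = \<ll> (src f) (src g) \<cdot> \<S> (f \<star>\<^sub>V g)"
    and \<rho>_nat: "\<S> (f \<star>\<^sub>V g) \<cdot> \<rho> (tgt f) (tgt g) = \<rho> (src f) (src g) \<cdot> (\<S> f \<star> \<E> g)"
proof -
  have fg: "src f \<in> cell1 A A" "tgt f \<in> cell1 A A" "src g \<in> cell1 A A" "tgt g \<in> cell1 A A"
    "cell f \<in> cell2 (src f) (tgt f)" "cell g \<in> cell2 (src g) (tgt g)"
    using assms arr_cell[OF assms(1)] arr_cell[OF assms(2)] by simp_all
  note nat = r_nat[OF A fg(1-4)] lam_nat[OF A fg(1-4)] u_nat[OF A fg(1-4)]
    s_nat[OF A fg(1-4)] l_nat[OF A fg(1-4)] rho_nat[OF A fg(1-4)]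
  show "(\<D> f \<star> \<C> g) \<cdot> \<rr> (tgt f) (tgt g) = \<rr> (src f) (src g) \<cdot> \<D> (f \<star>\<^sub>V g)"
    "\<D> (f \<star>\<^sub>V g) \<cdot> \<Lambda> (tgt f) (tgt g) = \<Lambda> (src f) (src g) \<cdot> (\<E> f \<star> \<D> g)"
    "(\<D> f \<star> \<S> g) \<cdot> \<uu> (tgt f) (tgt g) = \<uu> (src f) (src g) \<cdot> \<E> (f \<star>\<^sub>V g)"
    "\<C> (f \<star>\<^sub>V g) \<cdot> \<ss> (tgt f) (tgt g) = \<ss> (src f) (src g) \<cdot> (\<S> f \<star> \<D> g)"
    "(\<C> f \<star> \<S> g) \<cdot> \<ll> (tgt f) (tgt g) = \<ll> (src f) (src g) \<cdot> \<S> (f \<star>\<^sub>V g)"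
    "\<S> (f \<star>\<^sub>V g) \<cdot> \<rho> (tgt f) (tgt g) = \<rho> (src f) (src g) \<cdot> (\<S> f \<star> \<E> g)"
    by (rule arrow_eqI[of T]; use assms fg nat in simp)+
qed

lemma penumbra1_arrow:
  "\<lbrakk>M \<in> cell1 A A; N \<in> cell1 A A; P \<in> cell1 A A\<rbrakk>
    \<Longrightarrow> (\<ss> M N \<star> \<iota> (S \<cdot>\<^sub>o P)) \<cdot> \<alpha> (S \<cdot>\<^sub>o M) (D \<cdot>\<^sub>o N) (S \<cdot>\<^sub>o P) \<cdot> (\<iota> (S \<cdot>\<^sub>o M) \<star> \<uu> N P)
      = \<ll> (M \<odot> N) P \<cdot> \<S> (V.\<alpha> M N P) \<cdot> \<rho> M (N \<odot> P)"
  unfolding seq_assoc[symmetric] by (rule arrow_eqI[of T]) (simp_all add: penumbra1[OF A])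

lemma penumbra2_arrow:
  "\<lbrakk>M \<in> cell1 A A; N \<in> cell1 A A; P \<in> cell1 A A\<rbrakk>
    \<Longrightarrow> (\<iota> (D \<cdot>\<^sub>o M) \<star> \<ss> N P) \<cdot> \<alpha>' (D \<cdot>\<^sub>o M) (S \<cdot>\<^sub>o N) (D \<cdot>\<^sub>o P) \<cdot> (\<uu> M N \<star> \<iota> (D \<cdot>\<^sub>o P))
      = \<rr> M (N \<odot> P) \<cdot> \<D> (V.\<alpha>' M N P) \<cdot> \<Lambda> (M \<odot> N) P"
  unfolding seq_assoc[symmetric] by (rule arrow_eqI[of T]) (simp_all add: penumbra2[OF A])

text \<open>The unit axioms, with the coevaluation side solved for the inverse unitors, since these are the
  ones that begin a triangle identity.\<close>
lemma penumbra_unit: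
  assumes [simp]: "M \<in> cell1 A A"
  shows \<ll>_unit: "lun' (S \<cdot>\<^sub>o M) \<cdot> (\<ii> \<star> \<iota> (S \<cdot>\<^sub>o M)) \<cdot> \<ll> (U A) M = \<S> (V.lun' M)"
    and \<rr>_unit: "run' (D \<cdot>\<^sub>o M) \<cdot> (\<iota> (D \<cdot>\<^sub>o M) \<star> \<ii>) \<cdot> \<rr> M (U A) = \<D> (V.run' M)"
    and \<rho>_unit: "\<rho> M (U A) \<cdot> (\<iota> (S \<cdot>\<^sub>o M) \<star> \<ee>) \<cdot> run (S \<cdot>\<^sub>o M) = \<S> (V.run M)"
    and \<Lambda>_unit: "\<Lambda> (U A) M \<cdot> (\<ee> \<star> \<iota> (D \<cdot>\<^sub>o M)) \<cdot> lun (D \<cdot>\<^sub>o M) = \<D> (V.lun M)"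
proof -
  have l: "((\<ii> \<star> \<iota> (S \<cdot>\<^sub>o M)) \<cdot> \<ll> (U A) M) \<cdot> \<S> (V.lun M) = lun (S \<cdot>\<^sub>o M)"
    by (rule arrow_eqI[of T]) (simp_all add: penumbra5[OF A])
  have r: "((\<iota> (D \<cdot>\<^sub>o M) \<star> \<ii>) \<cdot> \<rr> M (U A)) \<cdot> \<D> (V.run M) = run (D \<cdot>\<^sub>o M)"
    by (rule arrow_eqI[of T]) (simp_all add: penumbra6[OF A])
  have "lun' (S \<cdot>\<^sub>o M) \<cdot> (\<ii> \<star> \<iota> (S \<cdot>\<^sub>o M)) \<cdot> \<ll> (U A) M
      = lun' (S \<cdot>\<^sub>o M) \<cdot> (((\<ii> \<star> \<iota> (S \<cdot>\<^sub>o M)) \<cdot> \<ll> (U A) M) \<cdot> \<S> (V.lun M)) \<cdot> \<S> (V.lun' M)"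
    by (simp add: seq_assoc S.fun_arrow_seq[symmetric])
  then show "lun' (S \<cdot>\<^sub>o M) \<cdot> (\<ii> \<star> \<iota> (S \<cdot>\<^sub>o M)) \<cdot> \<ll> (U A) M = \<S> (V.lun' M)"
    unfolding l by (simp add: inverse_cancel)
  have "run' (D \<cdot>\<^sub>o M) \<cdot> (\<iota> (D \<cdot>\<^sub>o M) \<star> \<ii>) \<cdot> \<rr> M (U A)
      = run' (D \<cdot>\<^sub>o M) \<cdot> (((\<iota> (D \<cdot>\<^sub>o M) \<star> \<ii>) \<cdot> \<rr> M (U A)) \<cdot> \<D> (V.run M)) \<cdot> \<D> (V.run' M)"
    by (simp add: seq_assoc D.fun_arrow_seq[symmetric])
  then show "run' (D \<cdot>\<^sub>o M) \<cdot> (\<iota> (D \<cdot>\<^sub>o M) \<star> \<ii>) \<cdot> \<rr> M (U A) = \<D> (V.run' M)"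
    unfolding r by (simp add: inverse_cancel)
  show "\<rho> M (U A) \<cdot> (\<iota> (S \<cdot>\<^sub>o M) \<star> \<ee>) \<cdot> run (S \<cdot>\<^sub>o M) = \<S> (V.run M)"
    unfolding seq_assoc[symmetric] by (rule arrow_eqI[of T]) (simp_all add: penumbra7[OF A])
  show "\<Lambda> (U A) M \<cdot> (\<ee> \<star> \<iota> (D \<cdot>\<^sub>o M)) \<cdot> lun (D \<cdot>\<^sub>o M) = \<D> (V.lun M)"
    unfolding seq_assoc[symmetric] by (rule arrow_eqI[of T]) (simp_all add: penumbra8[OF A])
qed

definition coev where "coev N N' f = \<ii> \<cdot> \<C> f \<cdot> \<ss> N N'"
definition ev where "ev N N' g = \<uu> N' N \<cdot> \<E> g \<cdot> \<ee>"

text \<open>The axiom relating \<open>s\<close>, \<open>u\<close> to \<open>l\<close>, \<open>rho\<close> replaces the detour through \<open>S(N) \<otimes> D(N') \<otimes> S(N)\<close>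
  by the associator under \<open>S\<close>. Then naturality of \<open>l\<close> and \<open>rho\<close> brings \<open>f\<close> and \<open>g\<close> under \<open>S\<close>
  as well, and their unit axioms turn what is left at the two ends into unitors. The result is the image under \<open>S\<close>
  of the triangle identity for \<open>(N, N')\<close>.\<close>
lemma penumbra_zigzag:
  assumes "V.zigzag N N' f g"
  shows "zigzag (S \<cdot>\<^sub>o N) (D \<cdot>\<^sub>o N') (coev N N' f) (ev N N' g)"
proof -
  have [simp]: "N \<in> cell1 A A" "N' \<in> cell1 A A" "arr (End B A) f" "src f = U A" "tgt f = N \<odot> N'"
     "arr (End B A) g" "src g = N' \<odot> N" "tgt g = U A"
    and zz: "V.lun' N \<cdot>\<^sub>V (f \<star>\<^sub>V V.\<iota> N) \<cdot>\<^sub>V V.\<alpha> N N' N \<cdot>\<^sub>V (V.\<iota> N \<star>\<^sub>V g) \<cdot>\<^sub>V V.run N = V.\<iota> N"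
    using assms by (auto simp: V.zigzag_def V.dual_shape_def)
  let ?SN = "S \<cdot>\<^sub>o N" and ?DN = "D \<cdot>\<^sub>o N'"
  have "lun' ?SN \<cdot> (coev N N' f \<star> \<iota> ?SN) \<cdot> \<alpha> ?SN ?DN ?SN \<cdot> (\<iota> ?SN \<star> ev N N' g) \<cdot> run ?SN
      = lun' ?SN \<cdot> (\<ii> \<star> \<iota> ?SN) \<cdot> (\<C> f \<star> \<iota> ?SN)
        \<cdot> ((\<ss> N N' \<star> \<iota> ?SN) \<cdot> \<alpha> ?SN ?DN ?SN \<cdot> (\<iota> ?SN \<star> \<uu> N' N)) \<cdot> (\<iota> ?SN \<star> \<E> g) \<cdot> (\<iota> ?SN \<star> \<ee>) \<cdot> run ?SN"
    by (simp add: coev_def ev_def whisker_left_seq whisker_right_seq seq_assoc)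
  also have "\<dots> = lun' ?SN \<cdot> (\<ii> \<star> \<iota> ?SN) \<cdot> ((\<C> f \<star> \<iota> ?SN) \<cdot> \<ll> (N \<odot> N') N) \<cdot> \<S> (V.\<alpha> N N' N)
        \<cdot> (\<rho> N (N' \<odot> N) \<cdot> (\<iota> ?SN \<star> \<E> g)) \<cdot> (\<iota> ?SN \<star> \<ee>) \<cdot> run ?SN"
    by (simp add: penumbra1_arrow seq_assoc)
  also have "\<dots> = (lun' ?SN \<cdot> (\<ii> \<star> \<iota> ?SN) \<cdot> \<ll> (U A) N) \<cdot> \<S> (f \<star>\<^sub>V V.\<iota> N) \<cdot> \<S> (V.\<alpha> N N' N)
        \<cdot> \<S> (V.\<iota> N \<star>\<^sub>V g) \<cdot> (\<rho> N (U A) \<cdot> (\<iota> ?SN \<star> \<ee>) \<cdot> run ?SN)"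
    using \<ll>_nat[of f "V.\<iota> N"] \<rho>_nat[of "V.\<iota> N" g, symmetric] by (simp add: seq_assoc)
  also have "\<dots> = \<S> (V.lun' N \<cdot>\<^sub>V (f \<star>\<^sub>V V.\<iota> N) \<cdot>\<^sub>V V.\<alpha> N N' N \<cdot>\<^sub>V (V.\<iota> N \<star>\<^sub>V g) \<cdot>\<^sub>V V.run N)"
    by (simp add: \<ll>_unit \<rho>_unit S.fun_arrow_seq)
  finally show ?thesis
    unfolding zz by (simp add: zigzag_def dual_shape_def coev_def ev_def)
qed

text \<open>The same argument for \<open>D\<close>, with \<open>r\<close> and \<open>lam\<close> in place of \<open>l\<close> and \<open>rho\<close>.\<close>
lemma penumbra_zagzig:
  assumes "V.zagzig N N' f g"
  shows "zagzig (S \<cdot>\<^sub>o N) (D \<cdot>\<^sub>o N') (coev N N' f) (ev N N' g)"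
proof -
  have [simp]: "N \<in> cell1 A A" "N' \<in> cell1 A A" "arr (End B A) f" "src f = U A" "tgt f = N \<odot> N'"
     "arr (End B A) g" "src g = N' \<odot> N" "tgt g = U A"
    and zz: "V.run' N' \<cdot>\<^sub>V (V.\<iota> N' \<star>\<^sub>V f) \<cdot>\<^sub>V V.\<alpha>' N' N N' \<cdot>\<^sub>V (g \<star>\<^sub>V V.\<iota> N') \<cdot>\<^sub>V V.lun N' = V.\<iota> N'"
    using assms by (auto simp: V.zagzig_def V.dual_shape_def)
  let ?SN = "S \<cdot>\<^sub>o N" and ?DN = "D \<cdot>\<^sub>o N'"
  have "run' ?DN \<cdot> (\<iota> ?DN \<star> coev N N' f) \<cdot> \<alpha>' ?DN ?SN ?DN \<cdot> (ev N N' g \<star> \<iota> ?DN) \<cdot> lun ?DN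
      = run' ?DN \<cdot> (\<iota> ?DN \<star> \<ii>) \<cdot> (\<iota> ?DN \<star> \<C> f)
        \<cdot> ((\<iota> ?DN \<star> \<ss> N N') \<cdot> \<alpha>' ?DN ?SN ?DN \<cdot> (\<uu> N' N \<star> \<iota> ?DN)) \<cdot> (\<E> g \<star> \<iota> ?DN) \<cdot> (\<ee> \<star> \<iota> ?DN) \<cdot> lun ?DN"
    by (simp add: coev_def ev_def whisker_left_seq whisker_right_seq seq_assoc)
  also have "\<dots> = run' ?DN \<cdot> (\<iota> ?DN \<star> \<ii>) \<cdot> ((\<iota> ?DN \<star> \<C> f) \<cdot> \<rr> N' (N \<odot> N')) \<cdot> \<D> (V.\<alpha>' N' N N')
        \<cdot> (\<Lambda> (N' \<odot> N) N' \<cdot> (\<E> g \<star> \<iota> ?DN)) \<cdot> (\<ee> \<star> \<iota> ?DN) \<cdot> lun ?DN"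
    by (simp add: penumbra2_arrow seq_assoc)
  also have "\<dots> = (run' ?DN \<cdot> (\<iota> ?DN \<star> \<ii>) \<cdot> \<rr> N' (U A)) \<cdot> \<D> (V.\<iota> N' \<star>\<^sub>V f) \<cdot> \<D> (V.\<alpha>' N' N N')
        \<cdot> \<D> (g \<star>\<^sub>V V.\<iota> N') \<cdot> (\<Lambda> (U A) N' \<cdot> (\<ee> \<star> \<iota> ?DN) \<cdot> lun ?DN)"
    using \<rr>_nat[of "V.\<iota> N'" f] \<Lambda>_nat[of g "V.\<iota> N'", symmetric] by (simp add: seq_assoc)
  also have "\<dots> = \<D> (V.run' N' \<cdot>\<^sub>V (V.\<iota> N' \<star>\<^sub>V f) \<cdot>\<^sub>V V.\<alpha>' N' N N' \<cdot>\<^sub>V (g \<star>\<^sub>V V.\<iota> N') \<cdot>\<^sub>V V.lun N')"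
    by (simp add: \<rr>_unit \<Lambda>_unit D.fun_arrow_seq)
  finally show ?thesis
    unfolding zz by (simp add: zagzig_def dual_shape_def coev_def ev_def)
qed

lemma penumbra_dual_arrows:
  "V.dual_arrows N N' f g \<Longrightarrow> dual_arrows (S \<cdot>\<^sub>o N) (D \<cdot>\<^sub>o N') (coev N N' f) (ev N N' g)"
  by (simp add: V.dual_arrows_def dual_arrows_def penumbra_zigzag penumbra_zagzig)

end

section \<open>Traces in an umbra\<close>

locale umbra_at = umbra + penumbra_at
begin

definition "\<Theta>\<^sub>S M N = Arr (S \<cdot>\<^sub>o (M \<odot> N)) (\<theta>S M N) (S \<cdot>\<^sub>o (N \<odot> M))"
definition "\<Theta>\<^sub>D M N = Arr (D \<cdot>\<^sub>o (M \<odot> N)) (\<theta>D M N) (D \<cdot>\<^sub>o (N \<odot> M))"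

lemma \<Theta>_sels [simp]:
  "src (\<Theta>\<^sub>S M N) = S \<cdot>\<^sub>o (M \<odot> N)" "tgt (\<Theta>\<^sub>S M N) = S \<cdot>\<^sub>o (N \<odot> M)" "cell (\<Theta>\<^sub>S M N) = \<theta>S M N"
  "src (\<Theta>\<^sub>D M N) = D \<cdot>\<^sub>o (M \<odot> N)" "tgt (\<Theta>\<^sub>D M N) = D \<cdot>\<^sub>o (N \<odot> M)" "cell (\<Theta>\<^sub>D M N) = \<theta>D M N"
  by (simp_all add: \<Theta>\<^sub>S_def \<Theta>\<^sub>D_def)

lemma arr_\<Theta> [simp]:
  assumes "M \<in> cell1 A A" "N \<in> cell1 A A"
  shows "arr T (\<Theta>\<^sub>S M N)" "arr T (\<Theta>\<^sub>D M N)"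
  using assms shadow_S.\<theta>_iso[OF A A assms] shadow_D.\<theta>_iso[OF A A assms]
  by (auto simp: \<Theta>\<^sub>S_def \<Theta>\<^sub>D_def inverse_pair_def)

lemma umbra_arrow:
  assumes "M \<in> cell1 A A" "N \<in> cell1 A A" "P \<in> cell1 A A"
  shows "\<ss> (M \<odot> N) P \<cdot> (\<Theta>\<^sub>S M N \<star> \<iota> (D \<cdot>\<^sub>o P)) \<cdot> \<sigma> (S \<cdot>\<^sub>o (N \<odot> M)) (D \<cdot>\<^sub>o P) \<cdot> \<uu> P (N \<odot> M)
    = \<C> (V.\<alpha> M N P) \<cdot> \<ss> M (N \<odot> P) \<cdot> (\<iota> (S \<cdot>\<^sub>o M) \<star> \<Theta>\<^sub>D N P)
        \<cdot> \<sigma> (S \<cdot>\<^sub>o M) (D \<cdot>\<^sub>o (P \<odot> N)) \<cdot> \<uu> (P \<odot> N) M \<cdot> \<E> (V.\<alpha> P N M)"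
  unfolding seq_assoc[symmetric]
  by (rule arrow_eqI[of T]) (use assms in \<open>simp_all add: umbra[OF A]\<close>)

text \<open>Naturality of \<open>s\<close> moves \<open>x\<close> back into \<open>C\<close>, and naturality of the symmetry and of \<open>u\<close> moves
  \<open>y\<close> forward into \<open>E\<close>. The bracketed factor that remains is one side of the umbra axiom.\<close>
lemma trace_S_factor:
  assumes [simp]: "N \<in> cell1 A A" "N' \<in> cell1 A A" "M' \<in> cell1 A A" "K \<in> cell1 A A"
    and [simp]: "arr (End B A) c" "src c = U A" "tgt c = N \<odot> N'"
      "arr (End B A) d" "src d = N' \<odot> N" "tgt d = U A"
      "arr (End B A) x" "src x = N" "tgt x = M' \<odot> K"
      "arr (End B A) y" "src y = K \<odot> M'" "tgt y = N"
  shows "trace (S \<cdot>\<^sub>o N) (D \<cdot>\<^sub>o N') (coev N N' c) (ev N N' d) (\<S> x \<cdot> \<Theta>\<^sub>S M' K \<cdot> \<S> y)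
    = \<ii> \<cdot> \<C> (c \<cdot>\<^sub>V (x \<star>\<^sub>V V.\<iota> N'))
      \<cdot> (\<ss> (M' \<odot> K) N' \<cdot> (\<Theta>\<^sub>S M' K \<star> \<iota> (D \<cdot>\<^sub>o N')) \<cdot> \<sigma> (S \<cdot>\<^sub>o (K \<odot> M')) (D \<cdot>\<^sub>o N') \<cdot> \<uu> N' (K \<odot> M'))
      \<cdot> \<E> ((V.\<iota> N' \<star>\<^sub>V y) \<cdot>\<^sub>V d) \<cdot> \<ee>"
  using \<ss>_nat[of x "V.\<iota> N'", THEN seq_extend] \<sigma>_nat[of "\<S> y" "\<iota> (D \<cdot>\<^sub>o N')", THEN seq_extend]
    \<uu>_nat[of "V.\<iota> N'" y, THEN seq_extend]
  by (simp add: trace_def coev_def ev_def whisker_right_seq functor_seq seq_assoc)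

lemma trace_D_factor:
  assumes [simp]: "M \<in> cell1 A A" "M' \<in> cell1 A A" "N' \<in> cell1 A A" "K \<in> cell1 A A"
    and [simp]: "arr (End B A) c" "src c = U A" "tgt c = M' \<odot> M"
      "arr (End B A) d" "src d = M \<odot> M'" "tgt d = U A"
      "arr (End B A) x" "src x = M" "tgt x = K \<odot> N'"
      "arr (End B A) y" "src y = N' \<odot> K" "tgt y = M"
  shows "coev M' M c \<cdot> (\<iota> (S \<cdot>\<^sub>o M') \<star> (\<D> x \<cdot> \<Theta>\<^sub>D K N' \<cdot> \<D> y)) \<cdot> \<sigma> (S \<cdot>\<^sub>o M') (D \<cdot>\<^sub>o M) \<cdot> ev M' M d
    = \<ii> \<cdot> \<C> (c \<cdot>\<^sub>V (V.\<iota> M' \<star>\<^sub>V x))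
      \<cdot> (\<ss> M' (K \<odot> N') \<cdot> (\<iota> (S \<cdot>\<^sub>o M') \<star> \<Theta>\<^sub>D K N') \<cdot> \<sigma> (S \<cdot>\<^sub>o M') (D \<cdot>\<^sub>o (N' \<odot> K)) \<cdot> \<uu> (N' \<odot> K) M')
      \<cdot> \<E> ((y \<star>\<^sub>V V.\<iota> M') \<cdot>\<^sub>V d) \<cdot> \<ee>"
  using \<ss>_nat[of "V.\<iota> M'" x, THEN seq_extend] \<sigma>_nat[of "\<iota> (S \<cdot>\<^sub>o M')" "\<D> y", THEN seq_extend]
    \<uu>_nat[of y "V.\<iota> M'", THEN seq_extend]
  by (simp add: coev_def ev_def whisker_left_seq functor_seq seq_assoc)

text \<open>The bicategorical traces as arrows, with the functor applied once to everything before the shadow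
  isomorphism and once to everything after it, which is the form needed for the two factorizations
  above.\<close>
definition left_trace where
  "left_trace M N M' c d p =
     \<S> (V.lun' N \<cdot>\<^sub>V (c \<star>\<^sub>V V.\<iota> N) \<cdot>\<^sub>V V.\<alpha> M' M N \<cdot>\<^sub>V (V.\<iota> M' \<star>\<^sub>V p))
     \<cdot> \<Theta>\<^sub>S M' (N \<odot> M)
     \<cdot> \<S> (V.\<alpha> N M M' \<cdot>\<^sub>V (V.\<iota> N \<star>\<^sub>V d) \<cdot>\<^sub>V V.run N)"

definition right_trace where
  "right_trace M N N' c d p =
     \<D> (V.run' M \<cdot>\<^sub>V (V.\<iota> M \<star>\<^sub>V c) \<cdot>\<^sub>V V.\<alpha>' M N N' \<cdot>\<^sub>V (p \<star>\<^sub>V V.\<iota> N'))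
     \<cdot> \<Theta>\<^sub>D (N \<odot> M) N'
     \<cdot> \<D> (V.\<alpha>' N' N M \<cdot>\<^sub>V (d \<star>\<^sub>V V.\<iota> M) \<cdot>\<^sub>V V.lun M)"

lemma left_trace_endo:
  assumes "V.dual_shape M' M c d" "N \<in> cell1 A A" "arr (End B A) p" "src p = M \<odot> N" "tgt p = N \<odot> M"
  shows "arr T (left_trace M N M' c d p)" "src (left_trace M N M' c d p) = S \<cdot>\<^sub>o N"
    "tgt (left_trace M N M' c d p) = S \<cdot>\<^sub>o N"
  using assms by (simp_all add: V.dual_shape_def left_trace_def)

lemma right_trace_endo:
  assumes "V.dual_shape N N' c d" "M \<in> cell1 A A" "arr (End B A) p" "src p = M \<odot> N" "tgt p = N \<odot> M"
  shows "arr T (right_trace M N N' c d p)" "src (right_trace M N N' c d p) = D \<cdot>\<^sub>o M"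
    "tgt (right_trace M N N' c d p) = D \<cdot>\<^sub>o M"
  using assms by (simp_all add: V.dual_shape_def right_trace_def)

text \<open>After the two factorizations the umbra axiom identifies the middle parts up to the associators
  of \<open>M', K, N'\<close> under \<open>C\<close> and of \<open>N', K, M'\<close> under \<open>E\<close>. The facts \<open>top\<close> and \<open>bottom\<close> absorb
  these associators into the outer 2-cells; \<open>p\<close> occurs only in \<open>top\<close>, where it slides past an
  associator by naturality.\<close>
lemma trace_left_trace_eq_trace_right_trace:
  assumes dM: "V.dual_arrows M' M cM dM" and dN: "V.dual_arrows N N' cN dN"
    and p [simp]: "arr (End B A) p" "src p = M \<odot> N" "tgt p = N \<odot> M"
  shows "trace (S \<cdot>\<^sub>o N) (D \<cdot>\<^sub>o N') (coev N N' cN) (ev N N' dN) (left_trace M N M' cM dM p)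
    = trace (D \<cdot>\<^sub>o M) (S \<cdot>\<^sub>o M') (coev M' M cM \<cdot> \<sigma> (S \<cdot>\<^sub>o M') (D \<cdot>\<^sub>o M))
        (\<sigma> (S \<cdot>\<^sub>o M') (D \<cdot>\<^sub>o M) \<cdot> ev M' M dM) (right_trace M N N' cN dN p)"
    (is "?lhs = ?rhs")
proof -
  have [simp]: "M \<in> cell1 A A" "M' \<in> cell1 A A" "N \<in> cell1 A A" "N' \<in> cell1 A A"
    "arr (End B A) cM" "src cM = U A" "tgt cM = M' \<odot> M"
    "arr (End B A) dM" "src dM = M \<odot> M'" "tgt dM = U A"
    "arr (End B A) cN" "src cN = U A" "tgt cN = N \<odot> N'"
    "arr (End B A) dN" "src dN = N' \<odot> N" "tgt dN = U A"
    and shapeN: "V.dual_shape N N' cN dN"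
    using dM dN by (auto simp: V.dual_arrows_def V.zigzag_def V.dual_shape_def)
  have shapeDM: "dual_shape (S \<cdot>\<^sub>o M') (D \<cdot>\<^sub>o M) (coev M' M cM) (ev M' M dM)"
    using penumbra_dual_arrows[OF dM] by (simp add: dual_arrows_def zigzag_def)
  let ?x = "V.lun' N \<cdot>\<^sub>V (cM \<star>\<^sub>V V.\<iota> N) \<cdot>\<^sub>V V.\<alpha> M' M N \<cdot>\<^sub>V (V.\<iota> M' \<star>\<^sub>V p)"
  let ?y = "V.\<alpha> N M M' \<cdot>\<^sub>V (V.\<iota> N \<star>\<^sub>V dM) \<cdot>\<^sub>V V.run N"
  let ?x' = "V.run' M \<cdot>\<^sub>V (V.\<iota> M \<star>\<^sub>V cN) \<cdot>\<^sub>V V.\<alpha>' M N N' \<cdot>\<^sub>V (p \<star>\<^sub>V V.\<iota> N')"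
  let ?y' = "V.\<alpha>' N' N M \<cdot>\<^sub>V (dN \<star>\<^sub>V V.\<iota> M) \<cdot>\<^sub>V V.lun M"
  let ?K = "N \<odot> M"
  \<comment> \<open>the side of the umbra axiom that contains the shadow isomorphism of \<open>D\<close>\<close>
  let ?twist = "\<ss> M' (?K \<odot> N') \<cdot> (\<iota> (S \<cdot>\<^sub>o M') \<star> \<Theta>\<^sub>D ?K N') \<cdot> \<sigma> (S \<cdot>\<^sub>o M') (D \<cdot>\<^sub>o (N' \<odot> ?K)) \<cdot> \<uu> (N' \<odot> ?K) M'"
  have top: "(cN \<cdot>\<^sub>V (?x \<star>\<^sub>V V.\<iota> N')) \<cdot>\<^sub>V V.\<alpha> M' ?K N' = cM \<cdot>\<^sub>V (V.\<iota> M' \<star>\<^sub>V ?x')"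
    using V.coev_slide[of M' M N N' cM cN, THEN V.seq_extend, of "V.\<iota> M' \<star>\<^sub>V (p \<star>\<^sub>V V.\<iota> N')"]
      V.\<alpha>_nat[of "V.\<iota> M'" p "V.\<iota> N'"]
    by (simp add: V.whisker_left_seq V.whisker_right_seq V.seq_assoc)
  have bottom: "V.\<alpha> N' ?K M' \<cdot>\<^sub>V (V.\<iota> N' \<star>\<^sub>V ?y) \<cdot>\<^sub>V dN = (?y' \<star>\<^sub>V V.\<iota> M') \<cdot>\<^sub>V dM"
    using V.ev_slide[of M' M N N' dM dN] by simp
  have "?lhs = \<ii> \<cdot> \<C> (cN \<cdot>\<^sub>V (?x \<star>\<^sub>V V.\<iota> N'))
      \<cdot> (\<C> (V.\<alpha> M' ?K N') \<cdot> ?twist \<cdot> \<E> (V.\<alpha> N' ?K M')) \<cdot> \<E> ((V.\<iota> N' \<star>\<^sub>V ?y) \<cdot>\<^sub>V dN) \<cdot> \<ee>"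
    unfolding left_trace_def
    by (subst trace_S_factor) (simp_all add: umbra_arrow seq_assoc)
  also have "\<dots> = \<ii> \<cdot> \<C> ((cN \<cdot>\<^sub>V (?x \<star>\<^sub>V V.\<iota> N')) \<cdot>\<^sub>V V.\<alpha> M' ?K N')
      \<cdot> ?twist \<cdot> \<E> (V.\<alpha> N' ?K M' \<cdot>\<^sub>V (V.\<iota> N' \<star>\<^sub>V ?y) \<cdot>\<^sub>V dN) \<cdot> \<ee>"
    by (simp add: functor_seq seq_assoc)
  also have "\<dots> = coev M' M cM \<cdot> (\<iota> (S \<cdot>\<^sub>o M') \<star> right_trace M N N' cN dN p) \<cdot> \<sigma> (S \<cdot>\<^sub>o M') (D \<cdot>\<^sub>o M) \<cdot> ev M' M dM"
    unfolding top bottom right_trace_def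
    by (subst trace_D_factor) simp_all
  also have "\<dots> = ?rhs"
    by (rule trace_swap[OF shapeDM right_trace_endo[OF shapeN], symmetric]) simp_all
  finally show ?thesis .
qed

lemma cell_left_trace:
  assumes "V.dual_shape M' M c d" "N \<in> cell1 A A" "arr (End B A) p" "src p = M \<odot> N" "tgt p = N \<odot> M"
  shows "cell (left_trace M N M' c d p)
    = trace_syntax.tr_left B T S \<theta>S M N M' (cell c) (cell d) (cell p)"
  using assms unfolding trace_syntax.tr_left_def left_trace_def V.dual_shape_def
  by (simp add: S.fun_arrow_seq seq_assoc[symmetric])

lemma cell_right_trace:
  assumes "V.dual_shape N N' c d" "M \<in> cell1 A A" "arr (End B A) p" "src p = M \<odot> N" "tgt p = N \<odot> M"
  shows "cell (right_trace M N N' c d p)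
    = trace_syntax.tr_right B T D \<theta>D M N N' (cell c) (cell d) (cell p)"
  using assms unfolding trace_syntax.tr_right_def right_trace_def V.dual_shape_def
  by (simp add: D.fun_arrow_seq seq_assoc[symmetric])

lemma dual_pair_arrows:
  "dual_pair A A N N' \<eta> \<epsilon> \<Longrightarrow> V.dual_arrows N N' (Arr (U A) \<eta> (N \<odot> N')) (Arr (N' \<odot> N) \<epsilon> (U A))"
  using V.dual_arrows_iff[of N N' \<eta> \<epsilon>] by (simp add: dual_pair_def V.mon_dual_pair_def)

end

section \<open>Equality of the two iterated traces\<close>

theorem theorem5p5:
  fixes B :: "('o, 'm, 'c) bicat" and T :: "('x, 'f) smcat"
    and S D C E :: "('m, 'c, 'x, 'f) fun_data"
    and r lam u s l rho :: "'m \<Rightarrow> 'm \<Rightarrow> 'f" and i e :: "'o \<Rightarrow> 'f"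
    and \<theta>S \<theta>D :: "'m \<Rightarrow> 'm \<Rightarrow> 'f"
    and A :: 'o and M N M' N' :: 'm and \<eta>M \<epsilon>M \<eta>N \<epsilon>N \<phi> :: 'c
  assumes "umbra B T S D C E r lam u s l rho i e \<theta>S \<theta>D"
    and "A \<in> Cell0 B" and "M \<in> Cell1 B A A" and "N \<in> Cell1 B A A"
    and M_left_dualizable: "bicat_syntax.dual_pair B A A M' M \<eta>M \<epsilon>M"
    and N_right_dualizable: "bicat_syntax.dual_pair B A A N N' \<eta>N \<epsilon>N"
    and "\<phi> \<in> Cell2 B (HComp1 B M N) (HComp1 B N M)"
  shows "moncat_syntax.mon_dualizable T (S \<cdot>\<^sub>o N)
    \<and> moncat_syntax.mon_dualizable T (D \<cdot>\<^sub>o M)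
    \<and> (\<forall>Z coevZ evZ W coevW evW.
        moncat_syntax.mon_dual_pair T (S \<cdot>\<^sub>o N) Z coevZ evZ \<longrightarrow>
        moncat_syntax.mon_dual_pair T (D \<cdot>\<^sub>o M) W coevW evW \<longrightarrow>
        mon_trace T (S \<cdot>\<^sub>o N) Z coevZ evZ
          (trace_syntax.tr_left B T S \<theta>S M N M' \<eta>M \<epsilon>M \<phi>)
        = mon_trace T (D \<cdot>\<^sub>o M) W coevW evW
          (trace_syntax.tr_right B T D \<theta>D M N N' \<eta>N \<epsilon>N \<phi>))"
proof -
  interpret umbra B T S D C E r lam u s l rho i e \<theta>S \<theta>D by fact
  interpret umbra_at B T S D C E r lam u s l rho i e \<theta>S \<theta>D A by unfold_locales fact
  note MN [simp] = \<open>M \<in> cell1 A A\<close> \<open>N \<in> cell1 A A\<close>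
  let ?cM = "Arr (U A) \<eta>M (M' \<odot> M)" and ?dM = "Arr (M \<odot> M') \<epsilon>M (U A)"
  let ?cN = "Arr (U A) \<eta>N (N \<odot> N')" and ?dN = "Arr (N' \<odot> N) \<epsilon>N (U A)"
  let ?p = "Arr (M \<odot> N) \<phi> (N \<odot> M)"
  have dM: "V.dual_arrows M' M ?cM ?dM" and dN: "V.dual_arrows N N' ?cN ?dN"
    using M_left_dualizable N_right_dualizable by (simp_all add: dual_pair_arrows)
  then have shapes: "V.dual_shape M' M ?cM ?dM" "V.dual_shape N N' ?cN ?dN"
    by (simp_all only: V.dual_arrows_def V.zigzag_def)
  have p: "arr (End B A) ?p" "src ?p = M \<odot> N" "tgt ?p = N \<odot> M"
    using \<open>\<phi> \<in> cell2 (M \<odot> N) (N \<odot> M)\<close> by simp_all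
  define h where "h = left_trace M N M' ?cM ?dM ?p"
  define k where "k = right_trace M N N' ?cN ?dN ?p"
  note h = left_trace_endo[OF shapes(1) MN(2) p, folded h_def]
  note k = right_trace_endo[OF shapes(2) MN(1) p, folded k_def]
  have hk: "cell h = trace_syntax.tr_left B T S \<theta>S M N M' \<eta>M \<epsilon>M \<phi>"
    "cell k = trace_syntax.tr_right B T D \<theta>D M N N' \<eta>N \<epsilon>N \<phi>"
    using cell_left_trace[OF shapes(1) MN(2) p] cell_right_trace[OF shapes(2) MN(1) p]
    by (simp_all add: h_def k_def)
  \<comment> \<open>the duals \<open>D(N')\<close> of \<open>S(N)\<close> and \<open>S(M')\<close> of \<open>D(M)\<close> provided by the umbra\<close>
  note dS = penumbra_dual_arrows[OF dN]
    and dD = dual_arrows_swap[OF penumbra_dual_arrows[OF dM]]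
  have "mon_trace T (S \<cdot>\<^sub>o N) Z c d (cell h) = mon_trace T (D \<cdot>\<^sub>o M) W c' d' (cell k)"
    if Z: "mon_dual_pair (S \<cdot>\<^sub>o N) Z c d" and W: "mon_dual_pair (D \<cdot>\<^sub>o M) W c' d'" for Z c d W c' d'
  proof -
    have zZ: "zigzag (S \<cdot>\<^sub>o N) Z (Arr I c (S \<cdot>\<^sub>o N \<otimes> Z)) (Arr (Z \<otimes> S \<cdot>\<^sub>o N) d I)"
      and zW: "zigzag (D \<cdot>\<^sub>o M) W (Arr I c' (D \<cdot>\<^sub>o M \<otimes> W)) (Arr (W \<otimes> D \<cdot>\<^sub>o M) d' I)"
      using Z W dual_arrows_iff by (auto simp: dual_arrows_def)
    have zS: "zigzag (S \<cdot>\<^sub>o N) (D \<cdot>\<^sub>o N') (coev N N' ?cN) (ev N N' ?dN)"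
      and zD: "zigzag (D \<cdot>\<^sub>o M) (S \<cdot>\<^sub>o M') (coev M' M ?cM \<cdot> \<sigma> (S \<cdot>\<^sub>o M') (D \<cdot>\<^sub>o M))
        (\<sigma> (S \<cdot>\<^sub>o M') (D \<cdot>\<^sub>o M) \<cdot> ev M' M ?dM)"
      using dS dD by (simp_all add: dual_arrows_def)
    show ?thesis
      unfolding cell_trace[OF Z h, symmetric] cell_trace[OF W k, symmetric]
        trace_dual_unique[OF zZ zS h] trace_dual_unique[OF zW zD k]
      unfolding h_def k_def trace_left_trace_eq_trace_right_trace[OF dM dN p] ..
  qed
  then show ?thesis
    using mon_dualizableI[OF dS] mon_dualizableI[OF dD] by (simp add: hk)
qed

end
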